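(* Let $W$ be the limit law of the normalized writhe $W_{2n+1}=w(\pi)/n$ ($\pi\in S_{2n+1}$ uniformly random, $n\to\infty$). Let $L_{mn}$, for integers $n\ge 1$ and odd integers $m\ge 1$, be independent identically distributed Laplace random variables, with density $f_L(x)=\tfrac12 e^{-|x|}$. Then $W$ has the same distribution as $$ \frac{4}{\pi^2} \;\sum_{n=1}^{\infty} \;\; \sum_{\substack{m\ge 1\\ m\ \mathrm{odd}}} \;\frac{L_{mn}}{mn}. $$
   Context: For a one-to-one function $f:\mathbb{Z}_{2n+1}\to\mathbb{R}$, where $\mathbb{Z}_{2n+1}=\mathbb{Z}/(2n+1)\mathbb{Z}$, the writhe of $f$ is $$ w(f) = \sum_{i=0}^{2n} \sum_{j=1}^{n} \mathrm{sign}\left(f(i+j)-f(i)\right), $$ where $i+j$ is taken in $\mathbb{Z}_{2n+1}$, and $\mathrm{sign}(x)=+1$ if $x>0$ and $-1$ if $x<0$. A permutation in $S_{2n+1}$ is viewed as a bijection of $\{0,\dots,2n\}$, the domain being identified with $\mathbb{Z}_{2n+1}$ and the values $0,\dots,2n$ being compared as integers. The normalized writhe $W_{2n+1}$ converges in distribution, as $n\to\infty$, to a law $W$ on $\mathbb{R}$ which is uniquely determined by its moment generating function, given near $z=0$ by $E[e^{Wz}]=\exp\left(\sum_{m=1}^\infty \frac{\lambda_m}{m}z^m\right)$, where $\lambda_m = \frac{8^m(2^m-1)B_m^2}{2(m!)^2}$ for even $m$, $\lambda_m=0$ for odd $m$, and $B_m$ is the $m$th Bernoulli number ($x/(e^x-1)=\sum_{m\ge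 0}B_m x^m/m!$). *)

theory Defs
  imports "HOL-Probability.Probability" "HOL-Computational_Algebra.Formal_Power_Series"
begin

text \<open>
  \<open>\<int>/(2n+1)\<int>\<close> is represented by \<open>{0..2 * n}\<close> with addition modulo \<open>2 * n + 1\<close>; only the
  values of \<open>f\<close> there matter.  The library's \<open>sgn\<close> is \<open>0\<close> at \<open>0\<close>, an argument that does not
  occur when \<open>f\<close> is injective on \<open>{0..2 * n}\<close>.
\<close>

definition writhe :: "nat \<Rightarrow> (nat \<Rightarrow> real) \<Rightarrow> real" where
  "writhe n f = (\<Sum>i = 0..2 * n. \<Sum>j = 1..n. sgn (f ((i + j) mod (2 * n + 1)) - f i))"

text \<open>The law of \<open>w(\<pi>)/n\<close>; the case \<open>n = 0\<close> is irrelevant for the limit.\<close>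

definition normalized_writhe_law :: "nat \<Rightarrow> real measure" where
  "normalized_writhe_law n =
     distr (measure_pmf (pmf_of_set {\<pi>. \<pi> permutes {0..2 * n}})) borel
       (\<lambda>\<pi>. writhe n (\<lambda>i. real (\<pi> i)) / real n)"

text \<open>The generating function \<open>x/(e\<^sup>x - 1) = \<Sum>m. B\<^sub>m x\<^sup>m/m!\<close>, hence \<open>B\<^sub>1 = -1/2\<close>.\<close>

definition bernoulli_number :: "nat \<Rightarrow> real" where
  "bernoulli_number m = fact m * fps_nth (fps_X / (fps_exp 1 - 1)) m"

definition writhe_lambda :: "nat \<Rightarrow> real" where
  "writhe_lambda m =
     (if even m then 8 ^ m * (2 ^ m - 1) * (bernoulli_number m)\<^sup>2 / (2 * (fact m)\<^sup>2) else 0)"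

definition laplace_density :: "real \<Rightarrow> real" where
  "laplace_density x = exp (- \<bar>x\<bar>) / 2"

end

theory Submission
  imports Defs "HOL-Complex_Analysis.Complex_Analysis"
begin

text \<open>
  A Laplace variable has characteristic function \<open>1/(1 + t\<^sup>2)\<close>, so the double series has characteristic
  function \<open>exp (- (\<Sum>n. \<Sum>m odd. ln (1 + (c t/(m n))\<^sup>2)))\<close> with \<open>c = 4/\<pi>\<^sup>2\<close>.  Expanding the logarithm gives a
  power series with coefficients \<open>\<zeta>(2j)\<^sup>2\<close>, and Euler's formula, read off from the product for \<open>sinh\<close>,
  identifies them with the \<open>\<lambda>\<^sub>2\<^sub>j\<close>.  Hence the two characteristic functions agree near \<open>0\<close>; since both laws
  have exponential moments, their moment generating functions are holomorphic on a vertical strip, and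
  the characteristic functions agree everywhere.

  Almost sure convergence uses no maximal inequality: with \<open>T\<^sub>n\<close> the partial sums of an independent
  sequence \<open>X\<close>, summation by parts reduces \<open>\<Sum>n. X\<^sub>n/n\<close> to \<open>T\<^sub>n/n \<longrightarrow> 0\<close> and to the absolutely convergent series
  \<open>\<Sum>n. T\<^sub>n/n\<^sup>2\<close>, which follow from \<open>E \<bar>T\<^sub>n\<bar> = O(\<surd>n)\<close> and \<open>E T\<^sub>n\<^sup>4 = O(n\<^sup>2)\<close>.
\<close>

section \<open>Even zeta values and Bernoulli numbers\<close>

text \<open>Domination by a product makes \<open>f\<close> absolutely summable over all pairs, so
  both iterated series converge to the unordered sum.\<close>

lemma sums_swap_product_bound:
  fixes f :: "nat \<Rightarrow> nat \<Rightarrow> real"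
  assumes bound: "\<And>k j. \<bar>f k j\<bar> \<le> a k * b j"
    and a: "summable a" "\<And>k. a k \<ge> 0" and b: "summable b" "\<And>j. b j \<ge> 0"
  obtains S where "(\<lambda>k. \<Sum>j. f k j) sums S" "(\<lambda>j. \<Sum>k. f k j) sums S"
proof -
  have ab: "(\<lambda>(k,j). a k * b j) summable_on UNIV \<times> UNIV"
  proof (rule summable_on_SigmaI[where g = "\<lambda>k. a k * suminf b"])
    have hb: "(b has_sum suminf b) UNIV"
      using b by (intro sums_nonneg_imp_has_sum) (auto simp: summable_sums)
    show "((\<lambda>y. case (x, y) of (k, j) \<Rightarrow> a k * b j) has_sum a x * suminf b) UNIV" for x
      using has_sum_cmult_right[OF hb, of "a x"] by simp
    show "(\<lambda>k. a k * suminf b) summable_on UNIV"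
      using a suminf_nonneg[OF b]
      by (intro summable_on_cmult_left summable_nonneg_imp_summable_on) auto
  qed (use a b in auto)
  have "(\<lambda>p. norm (case p of (k,j) \<Rightarrow> f k j)) summable_on UNIV \<times> UNIV"
    by (rule summable_on_comparison_test[OF ab]) (use bound in \<open>auto simp: split_def\<close>)
  hence S: "(\<lambda>(k,j). f k j) summable_on UNIV \<times> UNIV"
    by (rule abs_summable_summable)
  have sw: "(\<lambda>k. \<Sum>j. g k j) sums T"
    if "((\<lambda>(k,j). g k j) has_sum T) (UNIV \<times> UNIV)" for g :: "nat \<Rightarrow> nat \<Rightarrow> real" and T
  proof (rule has_sum_imp_sums, rule has_sum_SigmaD[OF that])
    fix k :: nat
    have "g k summable_on UNIV"
      using summable_on_SigmaD1[of g UNIV "\<lambda>_. UNIV" k] that has_sum_imp_summable by blast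
    then obtain c where c: "(g k has_sum c) UNIV"
      by (auto simp: summable_on_def)
    hence "(\<Sum>j. g k j) = c"
      using has_sum_imp_sums sums_unique by metis
    with c show "((\<lambda>j. case (k, j) of (k, j) \<Rightarrow> g k j) has_sum (\<Sum>j. g k j)) UNIV"
      by simp
  qed
  obtain T where T: "((\<lambda>(k,j). f k j) has_sum T) (UNIV \<times> UNIV)"
    using S by (auto simp only: summable_on_def)
  have "((\<lambda>(j,k). f k j) has_sum T) (UNIV \<times> UNIV)"
    using T by (subst (asm) has_sum_swap) (simp only: prod.case)
  with T show ?thesis
    using that sw by metis
qed

text \<open>The summand \<open>j = 0\<close> vanishes because of \<open>x / 0 = 0\<close>, whatever the value of the divergent \<open>\<Sum>k. u k ^ 0\<close>.\<close>

lemma ln_product_power_series: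
  fixes u :: "nat \<Rightarrow> real" and y :: real
  assumes y: "0 \<le> y" "y < 1" and u: "\<And>k. 0 \<le> u k" "\<And>k. u k \<le> 1" "summable u"
  obtains S where "(\<lambda>k. ln (1 + y * u k)) sums S"
    "(\<lambda>j. - ((-y) ^ j) / real j * (\<Sum>k. u k ^ j)) sums S"
proof -
  define f where "f = (\<lambda>k j. - ((- (y * u k)) ^ j) / real j)"
  have fe: "f k j = - ((-y) ^ j) / real j * u k ^ j" for k j
    by (simp add: f_def flip: power_mult_distrib)
  \<comment> \<open>As \<open>u k\<close> lies in the unit interval, \<open>u k ^ j\<close> is at
    most \<open>u k\<close> for \<open>j > 0\<close>; what remains is a summable sequence times a
    geometric one.\<close>
  have bd: "\<bar>f k j\<bar> \<le> u k * y ^ j" for k j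
  proof (cases j)
    case (Suc i)
    have "\<bar>f k j\<bar> = y ^ j * u k ^ j / real j"
      using u(1)[of k] y by (simp add: fe abs_mult power_abs)
    also have "\<dots> \<le> y ^ j * u k ^ j / 1"
      using Suc u(1)[of k] y by (intro divide_left_mono) auto
    finally have 1: "\<bar>f k j\<bar> \<le> y ^ j * u k ^ j / 1" .
    have "u k ^ j \<le> u k"
      using Suc u(1)[of k] u(2)[of k] by (simp add: mult_left_le power_le_one)
    hence "y ^ j * u k ^ j / 1 \<le> u k * y ^ j"
      using y by (metis div_by_1 mult.commute mult_left_mono zero_le_power)
    with 1 show ?thesis by linarith
  qed (simp add: f_def u)
  obtain S where S: "(\<lambda>k. \<Sum>j. f k j) sums S" "(\<lambda>j. \<Sum>k. f k j) sums S"
    using sums_swap_product_bound[of f u "\<lambda>j. y ^ j"] bd u y by (metis abs_of_nonneg real_norm_def summable_geometric zero_le_power)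
  have "(\<Sum>j. f k j) = ln (1 + y * u k)" for k
  proof -
    have "y * u k \<le> y * 1" using u y by (intro mult_left_mono) auto
    hence "y * u k < 1" using y by simp
    thus ?thesis
      unfolding f_def using ln_series'[of "y * u k"] u(1)[of k] y by (simp add: sums_iff)
  qed
  moreover have "(\<Sum>k. f k j) = - ((-y) ^ j) / real j * (\<Sum>k. u k ^ j)" for j
  proof (cases j)
    case (Suc i)
    have "u k ^ j \<le> u k" for k
      using Suc u(1)[of k] u(2)[of k] by (simp add: mult_left_le power_le_one)
    hence "summable (\<lambda>k. u k ^ j)"
      using u by (intro summable_comparison_test'[OF u(3)]) auto
    thus ?thesis unfolding fe by (rule suminf_mult)
  qed (simp add: fe)
  ultimately show ?thesis using S that by simp
qed

text \<open>The difference of the two series represents 0 near 0, whereas a nonzero power series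
  with zero constant term has an isolated zero there.\<close>

lemma has_fps_expansion_unique_real:
  fixes f :: "real \<Rightarrow> real"
  assumes "f has_fps_expansion F" "f has_fps_expansion G"
  shows "F = G"
proof (rule ccontr)
  define A where "A = F - G"
  assume "F \<noteq> G"
  then obtain m where m: "fps_nth A m \<noteq> 0"
    unfolding A_def by (metis eq_iff_diff_eq_0 fps_ext fps_zero_nth)
  have A: "(\<lambda>x. 0) has_fps_expansion A"
    using has_fps_expansion_diff[OF assms] by (simp add: A_def)
  then obtain r where r: "r > 0" "\<And>x. \<bar>x\<bar> < r \<Longrightarrow> eval_fps A x = 0" "ereal r < fps_conv_radius A"
  proof -
    obtain d where d: "d > 0" "\<And>x. dist x 0 < d \<Longrightarrow> eval_fps A x = 0"
      using A unfolding has_fps_expansion_def eventually_nhds_metric by blast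
    obtain e where e: "0 < ereal e" "ereal e < fps_conv_radius A"
      using A unfolding has_fps_expansion_def by (meson ereal_dense2 ereal_less(2))
    show ?thesis
      using d e by (intro that[of "min d e"]) (auto simp: min_def split: if_splits intro: le_less_trans[of "ereal d" "ereal e"])
  qed
  have sums: "(\<lambda>n. fps_nth A n * (x - 0) ^ n) sums 0" if "norm (x - 0) < r" for x
  proof -
    have "ereal (norm x) < fps_conv_radius A"
      using r(3) that by (intro less_trans[OF _ r(3)]) simp
    thus ?thesis using sums_eval_fps[of x A] r(2)[of x] that by simp
  qed
  have "fps_nth A 0 = 0"
    using sums_unique2[OF powser_sums_zero[of "fps_nth A"], of 0] sums[of 0] r(1) by simp
  hence "m > 0" using m by (cases m) auto
  from powser_0_nonzero[of r 0 "fps_nth A" "\<lambda>_. 0" m, OF r(1) sums refl m this]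
  obtain s where "s > 0" "\<And>z::real. z \<in> cball 0 s - {0} \<Longrightarrow> (0::real) \<noteq> 0" by blast
  from this(2)[of s] this(1) show False by simp
qed

section \<open>The product for the hyperbolic sine and Euler's formula for even zeta values\<close>

definition even_zeta :: "nat \<Rightarrow> real" where
  "even_zeta j = (\<Sum>k. (1 / (real (Suc k))\<^sup>2) ^ j)"

lemma summable_recip_squares: "summable (\<lambda>k. 1 / (real (Suc k))\<^sup>2)"
  using inverse_squares_sums by (simp add: sums_iff add.commute)

text \<open>This is the sine product at the argument \<open>\<i> * x\<close>: both sides are
  \<open>\<i>\<close> times a real number, so imaginary parts give the real statement.\<close>

lemma sinh_product_formula:
  "(\<lambda>n. pi * x * (\<Prod>k<n. 1 + x\<^sup>2 * (1 / (real (Suc k))\<^sup>2))) \<longlonglongrightarrow> sinh (pi * x)"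
proof -
  have "(\<lambda>n. of_real pi * (\<i> * of_real x) * (\<Prod>k=1..n. 1 - (\<i> * of_real x)^2 / of_nat k^2))
      \<longlonglongrightarrow> sin (of_real pi * (\<i> * complex_of_real x))"
    by (rule sin_product_formula_complex)
  moreover have "of_real pi * (\<i> * of_real x) * (\<Prod>k=1..n. 1 - (\<i> * of_real x)^2 / of_nat k^2) =
      \<i> * of_real (pi * x * (\<Prod>k<n. 1 + x\<^sup>2 * (1 / (real (Suc k))\<^sup>2)))" for n
  proof -
    have "(\<Prod>k=1..n. 1 - (\<i> * complex_of_real x)^2 / of_nat k^2) =
        (\<Prod>k<n. 1 - (\<i> * of_real x)^2 / of_nat (Suc k)^2)"
      by (rule prod.reindex_bij_witness[of _ Suc "\<lambda>k. k - 1"]) auto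
    also have "\<dots> = of_real (\<Prod>k<n. 1 + x\<^sup>2 * (1 / (real (Suc k))\<^sup>2))"
      unfolding of_real_prod by (intro prod.cong refl) (simp add: power_mult_distrib)
    finally show ?thesis by simp
  qed
  moreover have "sin (of_real pi * (\<i> * complex_of_real x)) = \<i> * of_real (sinh (pi * x))"
    by (simp add: sin_exp_eq sinh_def exp_of_real exp_minus algebra_simps scaleR_conv_of_real
        divide_simps flip: exp_of_real)
  ultimately have "(\<lambda>n. \<i> * complex_of_real (pi * x * (\<Prod>k<n. 1 + x\<^sup>2 * (1 / (real (Suc k))\<^sup>2))))
      \<longlonglongrightarrow> \<i> * of_real (sinh (pi * x))" by (simp only:)
  from tendsto_Im[OF this] show ?thesis
    by (simp only: Im_i_times Re_complex_of_real)
qed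

text \<open>Logarithms turn the product into a sum, which expands in powers of x^2 with coefficients
  built from zeta(2j). Keeping the factor \<open>pi * x\<close> on the right makes the second
  identity valid at 0 as well.\<close>

lemma sinh_eq_exp_suminf:
  assumes "\<bar>x\<bar> < 1"
  shows "(\<lambda>j. - ((- (x\<^sup>2)) ^ j) / real j * even_zeta j) sums (\<Sum>k. ln (1 + x\<^sup>2 * (1 / (real (Suc k))\<^sup>2)))"
    and "sinh (pi * x) = pi * x * exp (\<Sum>k. ln (1 + x\<^sup>2 * (1 / (real (Suc k))\<^sup>2)))"
proof -
  let ?u = "\<lambda>k. 1 / (real (Suc k))\<^sup>2"
  have x: "0 \<le> x\<^sup>2" "x\<^sup>2 < 1"
    using assms by (auto simp: abs_square_less_1)
  have u: "0 \<le> ?u k" "?u k \<le> 1" for k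
    by (auto simp: divide_simps)
  obtain S where S: "(\<lambda>k. ln (1 + x\<^sup>2 * ?u k)) sums S"
      "(\<lambda>j. - ((-(x\<^sup>2)) ^ j) / real j * (\<Sum>k. ?u k ^ j)) sums S"
    using ln_product_power_series[OF x u summable_recip_squares] by blast
  show "(\<lambda>j. - ((- (x\<^sup>2)) ^ j) / real j * even_zeta j) sums (\<Sum>k. ln (1 + x\<^sup>2 * ?u k))"
    using S unfolding even_zeta_def by (simp only: sums_iff)
  have "(\<Prod>k<n. 1 + x\<^sup>2 * ?u k) = exp (\<Sum>k<n. ln (1 + x\<^sup>2 * ?u k))" for n
    unfolding exp_sum[OF finite_lessThan]
    by (intro prod.cong refl exp_ln[symmetric] add_pos_nonneg mult_nonneg_nonneg u x) auto
  moreover have "(\<lambda>n. pi * x * exp (\<Sum>k<n. ln (1 + x\<^sup>2 * ?u k))) \<longlonglongrightarrow> pi * x * exp (\<Sum>k. ln (1 + x\<^sup>2 * ?u k))"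
    by (intro tendsto_intros summable_LIMSEQ sums_summable[OF S(1)])
  ultimately show "sinh (pi * x) = pi * x * exp (\<Sum>k. ln (1 + x\<^sup>2 * ?u k))"
    using LIMSEQ_unique[OF sinh_product_formula[of x]] by simp
qed

text \<open>Logarithmic differentiation of the product: if F is the power series of ln (sinh (pi x)
  / (pi x)), then pi x coth (pi x) = 1 + x F'(x), and the left side equals 2 pi x / (exp (2 pi x) -
  1) + pi x. The quotient is the Bernoulli generating function at 2 pi x, and the coefficients of
  x^(2j) are compared.\<close>

lemma bernoulli_number_even_zeta:
  assumes "j > 0"
  shows "bernoulli_number (2 * j) / fact (2 * j) * (2 * pi) ^ (2 * j) = - 2 * (-1) ^ j * even_zeta j"
proof -
  \<comment> \<open>The constant coefficient is 0 because of \<open>x / 0 = 0\<close>, in agreement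
    with \<open>P 0 = 0\<close>.\<close>
  define F where "F = Abs_fps (\<lambda>m. if even m then - ((-1) ^ (m div 2)) / real (m div 2) * even_zeta (m div 2) else 0)"
  define P where "P x = (\<Sum>k. ln (1 + x\<^sup>2 * (1 / (real (Suc k))\<^sup>2)))" for x
  have small: "\<forall>\<^sub>F x in nhds 0. \<bar>x\<bar> < (1::real)"
    using eventually_nhds_metric[of _ "0::real"] by (auto intro!: exI[of _ 1])
  have "P has_fps_expansion F"
  proof (rule has_fps_expansionI, rule eventually_mono[OF small])
    fix x :: real assume x: "\<bar>x\<bar> < 1"
    have "(\<lambda>j. fps_nth F (2 * j) * x ^ (2 * j)) sums P x"
      using sinh_eq_exp_suminf(1)[OF x] unfolding P_def
      by (rule back_subst[of "\<lambda>f. f sums _"])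
         (auto simp: F_def fun_eq_iff power_mult power_minus[of "x\<^sup>2"])
    thus "(\<lambda>n. fps_nth F n * x ^ n) sums P x"
      by (subst (asm) sums_mono_reindex[of "\<lambda>j. 2 * j"])
         (auto simp: strict_mono_def F_def elim!: evenE)
  qed
  hence radius: "fps_conv_radius F > 0" and P_eq: "\<forall>\<^sub>F x in nhds 0. eval_fps F x = P x"
    by (auto simp: has_fps_expansion_def)
  define D where "D = eval_fps (fps_deriv F)"
  have D: "D has_fps_expansion fps_deriv F"
    unfolding D_def using radius fps_conv_radius_deriv[of F]
    by (intro eval_fps_has_fps_expansion) auto
  have "\<forall>\<^sub>F x in nhds 0. sinh (pi * x) = pi * x * exp (eval_fps F x)"
    using small P_eq by eventually_elim (simp add: sinh_eq_exp_suminf(2) P_def)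
  \<comment> \<open>The identity holds in a whole neighbourhood of each point near 0, as comparing
    derivatives at \<open>x\<close> requires.\<close>
  hence "\<forall>\<^sub>F x in nhds 0. \<forall>\<^sub>F x in nhds x. sinh (pi * x) = pi * x * exp (eval_fps F x)"
    by (simp add: eventually_eventually)
  moreover have "\<forall>\<^sub>F x in nhds 0. x \<in> eball 0 (fps_conv_radius F)"
    using radius by (intro eventually_nhds_in_open) (auto simp: zero_ereal_def)
  ultimately have "\<forall>\<^sub>F x in nhds 0. (1 + x * D x - pi * x) * (exp (2 * pi * x) - 1) = 2 * pi * x"
  proof eventually_elim
    case (elim x)
    have s: "sinh (pi * x) = pi * x * exp (eval_fps F x)"
      using elim(1) eventually_nhds_x_imp_x by blast
    have 1: "((\<lambda>x. pi * x * exp (eval_fps F x)) has_field_derivative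
        pi * exp (eval_fps F x) + pi * x * (exp (eval_fps F x) * D x)) (at x)"
      unfolding D_def using elim(2)
      by (auto intro!: derivative_eq_intros has_field_derivative_eval_fps)
    have 2: "((\<lambda>x. sinh (pi * x)) has_field_derivative cosh (pi * x) * pi) (at x)"
      by (auto intro!: derivative_eq_intros)
    have "cosh (pi * x) * pi = pi * exp (eval_fps F x) + pi * x * (exp (eval_fps F x) * D x)"
      using DERIV_unique[OF 2] 1 DERIV_cong_ev[OF refl elim(1) refl] by blast
    \<comment> \<open>Multiplication by \<open>x\<close> lets the exponential be exchanged for the
      hyperbolic sine without dividing by \<open>x\<close>.\<close>
    hence "x * (cosh (pi * x) * pi) = x * (pi * exp (eval_fps F x) + pi * x * (exp (eval_fps F x) * D x))"
      by simp
    hence "x * pi * cosh (pi * x) = (1 + x * D x) * sinh (pi * x)"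
      unfolding s by (simp add: algebra_simps)
    hence "(1 + x * D x - pi * x) * sinh (pi * x) = pi * x * (cosh (pi * x) - sinh (pi * x))"
      by (simp add: algebra_simps)
    also have "cosh (pi * x) - sinh (pi * x) = exp (- (pi * x))"
      by (rule cosh_minus_sinh)
    finally have "(1 + x * D x - pi * x) * sinh (pi * x) * (2 * exp (pi * x)) = 2 * pi * x"
      by (simp add: exp_minus)
    moreover have "sinh (pi * x) * (2 * exp (pi * x)) = exp (2 * pi * x) - 1"
      by (simp add: sinh_def algebra_simps flip: exp_add)
    ultimately show ?case by (simp add: mult.assoc)
  qed
  note ev = this
  have "(\<lambda>x. (1 + x * D x - pi * x) * (exp (2 * pi * x) - 1)) has_fps_expansion
      (1 + fps_X * fps_deriv F - fps_const pi * fps_X) * (fps_exp (2 * pi) - 1)"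
    using D by (intro fps_expansion_intros)
  with ev have "(\<lambda>x. 2 * pi * x) has_fps_expansion
      (1 + fps_X * fps_deriv F - fps_const pi * fps_X) * (fps_exp (2 * pi) - 1)"
    by (subst (asm) has_fps_expansion_cong[OF ev refl])
  moreover have "(\<lambda>x. 2 * pi * x) has_fps_expansion fps_const (2 * pi) * fps_X"
    by (intro fps_expansion_intros)
  ultimately have eq: "(1 + fps_X * fps_deriv F - fps_const pi * fps_X) * (fps_exp (2 * pi) - 1) =
      fps_const (2 * pi) * fps_X"
    by (rule has_fps_expansion_unique_real)
  define B where "B = fps_X / (fps_exp 1 - 1 :: real fps)"
  have nz: "fps_exp (c::real) - 1 \<noteq> 0" "subdegree (fps_exp c - 1) = 1" if "c \<noteq> 0" for c
  proof -
    have "fps_nth (fps_exp c - 1) 1 \<noteq> 0" using that by simp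
    thus "fps_exp c - 1 \<noteq> 0" by (metis fps_zero_nth)
    show "subdegree (fps_exp c - 1) = 1"
      using that by (intro subdegreeI) auto
  qed
  have "B * (fps_exp 1 - 1) = fps_X"
    unfolding B_def using nz[of 1] by (intro dvd_div_mult_self) (auto simp: fps_dvd_iff)
  \<comment> \<open>Substituting \<open>2 * pi * X\<close> into the defining equation of
    \<open>B\<close> gives the right-hand side of \<open>eq\<close>, so the two cofactors of the
    nonzero series \<open>fps_exp (2 * pi) - 1\<close> coincide.\<close>
  hence "(B oo (fps_const (2 * pi) * fps_X)) * ((fps_exp 1 - 1) oo (fps_const (2 * pi) * fps_X)) =
      fps_X oo (fps_const (2 * pi) * fps_X)"
    by (subst fps_compose_mult_distrib[symmetric]) auto
  hence "(B oo (fps_const (2 * pi) * fps_X)) * (fps_exp (2 * pi) - 1) = fps_const (2 * pi) * fps_X"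
    by (simp add: fps_compose_sub_distrib)
  with eq have "(B oo (fps_const (2 * pi) * fps_X)) * (fps_exp (2 * pi) - 1) =
      (1 + fps_X * fps_deriv F - fps_const pi * fps_X) * (fps_exp (2 * pi) - 1)"
    by (simp only:)
  hence "(B oo (fps_const (2 * pi) * fps_X)) = 1 + fps_X * fps_deriv F - fps_const pi * fps_X"
    by (rule mult_right_cancel[THEN iffD1, rotated]) (use nz(1)[of "2 * pi"] in simp)
  hence "(2 * pi) ^ (2 * j) * fps_nth B (2 * j) =
      fps_nth (1 + fps_X * fps_deriv F - fps_const pi * fps_X) (2 * j)"
    by (simp only: flip: fps_nth_compose_linear)
  \<comment> \<open>As \<open>2 * j\<close> is positive and even, neither the constant nor the
    linear term contributes.\<close>
  also have "\<dots> = - 2 * (-1) ^ j * even_zeta j"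
  proof -
    obtain i where "j = Suc i" using assms by (cases j) auto
    thus ?thesis by (simp add: F_def divide_simps)
  qed
  finally show ?thesis
    unfolding bernoulli_number_def B_def by (simp add: mult.commute)
qed

section \<open>Double products and the series of the writhe coefficients\<close>

lemma summable_powers_unit_interval:
  fixes u :: "nat \<Rightarrow> real"
  assumes u: "\<And>k. 0 \<le> u k" "\<And>k. u k \<le> 1" "summable u" and "j > 0"
  shows "summable (\<lambda>k. u k ^ j)" "(\<Sum>k. u k ^ j) \<le> suminf u" "0 \<le> (\<Sum>k. u k ^ j)"
proof -
  have le: "u k ^ j \<le> u k" for k
    using u(1)[of k] u(2)[of k] \<open>j > 0\<close> by (cases j) (auto simp: mult_left_le power_le_one)
  show s: "summable (\<lambda>k. u k ^ j)"
    using le u by (intro summable_comparison_test'[OF u(3)]) auto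
  show "(\<Sum>k. u k ^ j) \<le> suminf u"
    using le s u(3) by (rule suminf_le)
  show "0 \<le> (\<Sum>k. u k ^ j)"
    using s u(1) by (intro suminf_nonneg) auto
qed

text \<open>For fixed \<open>n\<close> the inner sum is the single-product expansion at
  \<open>y * v n\<close>, whose coefficients involve power sums of \<open>u\<close>; a second
  interchange turns the powers of \<open>v n\<close> into power sums of \<open>v\<close>.\<close>

lemma ln_double_product_power_series:
  fixes u v :: "nat \<Rightarrow> real" and y :: real
  assumes y: "0 \<le> y" "y < 1"
    and u: "\<And>k. 0 \<le> u k" "\<And>k. u k \<le> 1" "summable u"
    and v: "\<And>k. 0 \<le> v k" "\<And>k. v k \<le> 1" "summable v"
  obtains S where "(\<lambda>n. \<Sum>k. ln (1 + y * v n * u k)) sums S"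
    "(\<lambda>j. - ((-y) ^ j) / real j * ((\<Sum>k. u k ^ j) * (\<Sum>n. v n ^ j))) sums S"
proof -
  define f where "f = (\<lambda>n j. - ((- (y * v n)) ^ j) / real j * (\<Sum>k. u k ^ j))"
  have fe: "f n j = (- ((-y) ^ j) / real j * (\<Sum>k. u k ^ j)) * v n ^ j" for n j
  proof -
    have "(- (y * v n)) ^ j = (-y) ^ j * v n ^ j"
      by (simp flip: power_mult_distrib)
    thus ?thesis by (simp add: f_def)
  qed
  have bd: "\<bar>f n j\<bar> \<le> v n * (y ^ j * suminf u)" for n j
  proof (cases "j = 0")
    case False
    hence j: "j > 0" "real j \<ge> 1" by auto
    have "\<bar>f n j\<bar> = y ^ j / real j * (\<Sum>k. u k ^ j) * v n ^ j"
      using v(1)[of n] y summable_powers_unit_interval(3)[OF u j(1)]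
      by (simp add: fe abs_mult power_abs)
    also have "\<dots> \<le> y ^ j / 1 * suminf u * v n"
    proof (intro mult_mono divide_left_mono)
      show "v n ^ j \<le> v n"
        using v(1)[of n] v(2)[of n] j by (cases j) (auto simp: mult_left_le power_le_one)
    qed (use y j u v summable_powers_unit_interval[OF u j(1)] in \<open>auto intro!: mult_nonneg_nonneg suminf_nonneg\<close>)
    finally show ?thesis by (simp add: mult_ac)
  qed (use v u suminf_nonneg[OF u(3)] in \<open>simp add: f_def\<close>)
  obtain S where S: "(\<lambda>n. \<Sum>j. f n j) sums S" "(\<lambda>j. \<Sum>n. f n j) sums S"
  proof (rule sums_swap_product_bound[OF bd])
    show "summable (\<lambda>j. y ^ j * suminf u)"
      using y by (intro summable_mult2 summable_geometric) auto
  qed (use u v y suminf_nonneg[OF u(3)] in auto)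
  have "(\<Sum>j. f n j) = (\<Sum>k. ln (1 + y * v n * u k))" for n
  proof -
    have "y * v n \<le> y * 1" using v y by (intro mult_left_mono) auto
    hence "y * v n < 1" "0 \<le> y * v n" using y v by auto
    then obtain T where "(\<lambda>k. ln (1 + y * v n * u k)) sums T" "(\<lambda>j. f n j) sums T"
      using ln_product_power_series[of "y * v n" u] u unfolding f_def by blast
    thus ?thesis by (simp add: sums_iff)
  qed
  moreover have "(\<Sum>n. f n j) = - ((-y) ^ j) / real j * ((\<Sum>k. u k ^ j) * (\<Sum>n. v n ^ j))" for j
  proof (cases "j = 0")
    case False
    thus ?thesis
      unfolding fe by (subst suminf_mult) (auto intro: summable_powers_unit_interval[OF v])
  qed (simp add: fe)
  ultimately show ?thesis using S that by simp
qed

lemma recip_square_bounds: "0 \<le> 1 / (real (Suc k))\<^sup>2" "1 / (real (Suc k))\<^sup>2 \<le> 1"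
  by (auto simp: divide_simps)

lemma recip_odd_square_bounds: "0 \<le> 1 / (real (2 * k + 1))\<^sup>2" "1 / (real (2 * k + 1))\<^sup>2 \<le> 1"
  by (auto simp: divide_simps)

lemma summable_recip_odd_squares: "summable (\<lambda>k. 1 / (real (2 * k + 1))\<^sup>2)"
  by (rule summable_comparison_test'[OF summable_recip_squares])
     (auto intro!: divide_left_mono power_mono)

text \<open>Grouping the zeta series in consecutive pairs separates odd from even bases, and the
  even ones contribute \<open>1 / 4 ^ j\<close> times the whole sum.\<close>

lemma suminf_recip_odd_powers:
  assumes "j > 0"
  shows "(\<Sum>k. (1 / (real (2 * k + 1))\<^sup>2) ^ j) = (1 - 1 / 4 ^ j) * even_zeta j"
proof -
  let ?f = "\<lambda>k. (1 / (real (Suc k))\<^sup>2) ^ j"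
  have f: "?f sums even_zeta j"
    unfolding even_zeta_def
    by (intro summable_sums summable_powers_unit_interval(1)[OF recip_square_bounds summable_recip_squares assms])
  have "(\<lambda>n. sum ?f {n * 2..<n * 2 + 2}) sums even_zeta j"
    by (rule sums_group[OF f]) simp
  moreover have "sum ?f {n * 2..<n * 2 + 2} = (1 / (real (2 * n + 1))\<^sup>2) ^ j + 1 / 4 ^ j * ?f n" for n
  proof -
    have "{n * 2..<n * 2 + 2} = {2 * n, Suc (2 * n)}" by auto
    moreover have "?f (Suc (2 * n)) = 1 / 4 ^ j * ?f n"
    proof -
      have "1 / (real (Suc (Suc (2 * n))))\<^sup>2 = 1 / 4 * (1 / (real (Suc n))\<^sup>2)"
        by (simp add: divide_simps power2_eq_square algebra_simps)
      thus ?thesis by (simp only: power_mult_distrib power_one_over)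
    qed
    ultimately show ?thesis by (simp add: add.commute)
  qed
  ultimately have "(\<lambda>n. (1 / (real (2 * n + 1))\<^sup>2) ^ j + 1 / 4 ^ j * ?f n) sums even_zeta j"
    by simp
  from sums_diff[OF this sums_mult[OF f, of "1 / 4 ^ j"]]
  show ?thesis by (simp add: sums_iff algebra_simps)
qed

text \<open>Squaring Euler's formula removes the sign, and the factor 2^m - 1 with
  \<open>m = 2 * j\<close> turns one of the two zeta values into the sum over odd numbers. The
  constant \<open>4 / pi\<^sup>2\<close> of the double series arises here.\<close>

lemma writhe_lambda_even_zeta:
  assumes "j > 0"
  shows "writhe_lambda (2 * j) / real (2 * j) =
    ((4 / pi\<^sup>2)\<^sup>2) ^ j / real j * ((\<Sum>k. (1 / (real (2 * k + 1))\<^sup>2) ^ j) * even_zeta j)"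
proof -
  define b where "b = bernoulli_number (2 * j) / fact (2 * j)"
  have "b * (2 * pi) ^ (2 * j) = - 2 * (-1) ^ j * even_zeta j"
    unfolding b_def by (rule bernoulli_number_even_zeta[OF assms])
  hence "(b * (2 * pi) ^ (2 * j))\<^sup>2 = (- 2 * (-1) ^ j * even_zeta j)\<^sup>2"
    by (rule arg_cong)
  hence b: "b\<^sup>2 * (16 * pi ^ 4) ^ j = 4 * (even_zeta j)\<^sup>2"
    by (simp add: power_mult_distrib power_mult flip: power_even_eq)
  have "writhe_lambda (2 * j) = 8 ^ (2 * j) * (2 ^ (2 * j) - 1) * b\<^sup>2 / 2"
    by (simp add: writhe_lambda_def b_def power_divide)
  also have "8 ^ (2 * j) = (64 ::real) ^ j" by (simp add: power_mult)
  also have "2 ^ (2 * j) = (4 ::real) ^ j" by (simp add: power_mult)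
  also have "b\<^sup>2 = 4 * (even_zeta j)\<^sup>2 / (16 * pi ^ 4) ^ j"
    using b by (simp add: field_simps)
  also have "64 ^ j * (4 ^ j - 1) * (4 * (even_zeta j)\<^sup>2 / (16 * pi ^ 4) ^ j) / 2 =
      2 * (64 / (16 * pi ^ 4)) ^ j * (4 ^ j - 1) * (even_zeta j)\<^sup>2"
    by (simp only: power_divide) simp
  also have "64 / (16 * pi ^ 4) = (4 / pi\<^sup>2)\<^sup>2 * (1 / 4)"
    by (simp add: power_divide)
  also have "2 * ((4 / pi\<^sup>2)\<^sup>2 * (1 / 4)) ^ j * (4 ^ j - 1) * (even_zeta j)\<^sup>2 =
      2 * ((4 / pi\<^sup>2)\<^sup>2) ^ j * ((1 - 1 / 4 ^ j) * even_zeta j * even_zeta j)"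
    by (simp only: power_mult_distrib[of _ "1/4"]) (simp add: field_simps power2_eq_square[of "even_zeta j"] power_divide)
  finally show ?thesis
    unfolding suminf_recip_odd_powers[OF assms] by simp
qed

text \<open>Both power sums are bounded uniformly in \<open>j > 0\<close>, so a geometric series of
  ratio (4 z / pi^2)^2 dominates the even terms; the odd terms vanish.\<close>

lemma summable_writhe_lambda:
  fixes z :: real
  assumes z: "\<bar>4 / pi\<^sup>2 * z\<bar> < 1"
  shows "summable (\<lambda>m. writhe_lambda m / real m * z ^ m)"
proof -
  let ?u = "\<lambda>k. 1 / (real (2 * k + 1))\<^sup>2" and ?v = "\<lambda>k. 1 / (real (Suc k))\<^sup>2"
  define y where "y = (4 / pi\<^sup>2 * z)\<^sup>2"
  have y: "0 \<le> y" "y < 1"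
    using z by (auto simp: y_def abs_square_less_1)
  have "summable (\<lambda>j. writhe_lambda (2 * j) / real (2 * j) * z ^ (2 * j))"
  proof (rule summable_comparison_test')
    show "summable (\<lambda>j. y ^ j * (suminf ?u * suminf ?v))"
      using y by (intro summable_mult2 summable_geometric) auto
    show "norm (writhe_lambda (2 * j) / real (2 * j) * z ^ (2 * j)) \<le> y ^ j * (suminf ?u * suminf ?v)" if "j \<ge> 1" for j
    proof -
      have j: "j > 0" "real j \<ge> 1" using that by auto
      note u = summable_powers_unit_interval[OF recip_odd_square_bounds summable_recip_odd_squares j(1)]
      note v = summable_powers_unit_interval[OF recip_square_bounds summable_recip_squares j(1), folded even_zeta_def]
      have "writhe_lambda (2 * j) / real (2 * j) * z ^ (2 * j) = y ^ j / real j * ((\<Sum>k. ?u k ^ j) * even_zeta j)"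
        unfolding y_def power_mult_distrib[of "4 / pi\<^sup>2" z 2] power_mult_distrib[of _ "z\<^sup>2" j]
        by (simp only: writhe_lambda_even_zeta[OF j(1)]) (simp add: power_mult)
      moreover have "\<bar>y ^ j / real j * ((\<Sum>k. ?u k ^ j) * even_zeta j)\<bar> =
          y ^ j / real j * ((\<Sum>k. ?u k ^ j) * even_zeta j)"
        using y u v by (intro abs_of_nonneg mult_nonneg_nonneg divide_nonneg_nonneg) auto
      moreover have "\<dots> \<le> y ^ j / 1 * (suminf ?u * suminf ?v)"
        using y u v j by (intro mult_mono divide_left_mono) auto
      ultimately show ?thesis by (simp only: real_norm_def div_by_1)
    qed
  qed
  hence "(\<lambda>j. writhe_lambda (2 * j) / real (2 * j) * z ^ (2 * j)) sums
      (\<Sum>j. writhe_lambda (2 * j) / real (2 * j) * z ^ (2 * j))" by (rule summable_sums)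
  hence "(\<lambda>m. writhe_lambda m / real m * z ^ m) sums
      (\<Sum>j. writhe_lambda (2 * j) / real (2 * j) * z ^ (2 * j))"
    by (subst (asm) sums_mono_reindex[of "\<lambda>j. 2 * j" "\<lambda>m. writhe_lambda m / real m * z ^ m"])
       (auto simp: strict_mono_def writhe_lambda_def elim!: evenE)
  thus ?thesis by (rule sums_summable)
qed

text \<open>At imaginary arguments z^(2j) = (-1)^j t^(2j), which produces the alternating signs of
  the logarithm series. The exponential of the second series is thus the product of all 1 / (1 + (4
  t / (pi^2 m n))^2) with m odd.\<close>

lemma writhe_lambda_imaginary_series:
  assumes t: "\<bar>4 / pi\<^sup>2 * t\<bar> < 1"
  obtains S where
    "(\<lambda>n. \<Sum>k. ln (1 + (4 / pi\<^sup>2 * t / real (Suc n) / real (2 * k + 1))\<^sup>2)) sums S"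
    "(\<lambda>m. complex_of_real (writhe_lambda m / real m) * (\<i> * of_real t) ^ m) sums of_real (- S)"
proof -
  let ?u = "\<lambda>k. 1 / (real (2 * k + 1))\<^sup>2" and ?v = "\<lambda>k. 1 / (real (Suc k))\<^sup>2"
  define y where "y = (4 / pi\<^sup>2 * t)\<^sup>2"
  have y: "0 \<le> y" "y < 1"
    using t by (auto simp: y_def abs_square_less_1)
  obtain S where S: "(\<lambda>n. \<Sum>k. ln (1 + y * ?v n * ?u k)) sums S"
    "(\<lambda>j. - ((-y) ^ j) / real j * ((\<Sum>k. ?u k ^ j) * even_zeta j)) sums S"
    using ln_double_product_power_series[OF y recip_odd_square_bounds summable_recip_odd_squares
        recip_square_bounds summable_recip_squares] unfolding even_zeta_def by blast
  have "(\<lambda>j. complex_of_real (- (- ((-y) ^ j) / real j * ((\<Sum>k. ?u k ^ j) * even_zeta j)))) sums of_real (- S)"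
    using sums_minus[OF S(2)] by (subst sums_of_real_iff)
  moreover have "complex_of_real (- (- ((-y) ^ j) / real j * ((\<Sum>k. ?u k ^ j) * even_zeta j))) =
      complex_of_real (writhe_lambda (2 * j) / real (2 * j)) * (\<i> * of_real t) ^ (2 * j)" for j
  proof (cases "j = 0")
    case False
    hence j: "j > 0" by simp
    have "(\<i> * complex_of_real t) ^ (2 * j) = of_real ((- (t\<^sup>2)) ^ j)"
      by (simp add: power_mult power_mult_distrib)
    moreover have "- (- ((-y) ^ j) / real j * ((\<Sum>k. ?u k ^ j) * even_zeta j)) =
        writhe_lambda (2 * j) / real (2 * j) * (- (t\<^sup>2)) ^ j"
    proof -
      have "(-y) ^ j = ((4 / pi\<^sup>2)\<^sup>2) ^ j * (- (t\<^sup>2)) ^ j"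
        unfolding y_def by (simp flip: power_mult_distrib)
      thus ?thesis
        by (simp only: writhe_lambda_even_zeta[OF j]) simp
    qed
    ultimately show ?thesis by (simp only: of_real_mult)
  qed simp
  ultimately have "(\<lambda>j. complex_of_real (writhe_lambda (2 * j) / real (2 * j)) * (\<i> * of_real t) ^ (2 * j)) sums of_real (- S)"
    by (simp only:)
  hence "(\<lambda>m. complex_of_real (writhe_lambda m / real m) * (\<i> * of_real t) ^ m) sums of_real (- S)"
    by (subst (asm) sums_mono_reindex[of "\<lambda>j. 2 * j"
          "\<lambda>m. complex_of_real (writhe_lambda m / real m) * (\<i> * of_real t) ^ m"])
       (auto simp: strict_mono_def writhe_lambda_def elim!: evenE)
  moreover have "y * ?v n * ?u k = (4 / pi\<^sup>2 * t / real (Suc n) / real (2 * k + 1))\<^sup>2" for n k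
    by (simp only: y_def power_divide power_mult_distrib) simp
  ultimately show ?thesis using S(1) that by (simp only:)
qed

section \<open>Analytic continuation of characteristic functions\<close>

text \<open>On the real axis this is the moment generating function, on the imaginary axis the
  characteristic function; holomorphy links the two.\<close>

definition bilateral_mgf :: "real measure \<Rightarrow> complex \<Rightarrow> complex" where
  "bilateral_mgf M z = (\<integral>x. exp (z * of_real x) \<partial>M)"

lemma (in real_distribution) integrable_exp_abs:
  assumes "integrable M (\<lambda>x. exp (d * x))" "integrable M (\<lambda>x. exp (- d * x))" "0 \<le> c" "c \<le> d"
  shows "integrable M (\<lambda>x. exp (c * \<bar>x\<bar>))"
proof (rule Bochner_Integration.integrable_bound[OF Bochner_Integration.integrable_add[OF assms(1,2)]])
  show "AE x in M. norm (exp (c * \<bar>x\<bar>)) \<le> norm (exp (d * x) + exp (- d * x))"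
  proof (intro AE_I2)
    fix x :: real
    have "c * \<bar>x\<bar> \<le> d * \<bar>x\<bar>" using assms by (intro mult_right_mono) auto
    hence "exp (c * \<bar>x\<bar>) \<le> exp (d * \<bar>x\<bar>)" by simp
    also have "\<dots> \<le> exp (d * x) + exp (- d * x)" by (cases "x \<ge> 0") auto
    finally show "norm (exp (c * \<bar>x\<bar>)) \<le> norm (exp (d * x) + exp (- d * x))" by simp
  qed
qed simp

text \<open>With h = w - i t, the integrand is exp (i t x) exp (h x), and the second factor is
  expanded. All partial sums are bounded by exp (d |x|), so dominated convergence permits
  integration term by term.\<close>

lemma (in real_distribution) bilateral_mgf_power_series:
  assumes int: "integrable M (\<lambda>x. exp (d * \<bar>x\<bar>))"
    and w: "cmod (w - \<i> * of_real t) < d"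
  shows "(\<lambda>n. (\<integral>x. exp (\<i> * of_real t * of_real x) * of_real x ^ n / fact n \<partial>M) * (w - \<i> * of_real t) ^ n)
           sums bilateral_mgf M w"
proof -
  define h where "h = w - \<i> * of_real t"
  define f where "f n x = exp (\<i> * of_real t * of_real x) * of_real x ^ n / fact n * h ^ n" for n and x :: real
  have norm_f: "norm (f n x) = (cmod h * \<bar>x\<bar>) ^ n / fact n" for n x
    by (simp add: f_def norm_mult norm_divide norm_power power_mult_distrib)
  have bound: "(\<Sum>n\<in>A. (cmod h * \<bar>x\<bar>) ^ n / fact n) \<le> exp (d * \<bar>x\<bar>)" if "finite A" for A and x :: real
  proof -
    have "(\<Sum>n\<in>A. (cmod h * \<bar>x\<bar>) ^ n / fact n) \<le> exp (cmod h * \<bar>x\<bar>)"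
      using sum_le_suminf[OF summable_exp_generic[of "cmod h * \<bar>x\<bar>"] that]
      by (simp add: exp_def divide_inverse mult.commute)
    also have "\<dots> \<le> exp (d * \<bar>x\<bar>)"
      using w by (auto simp: h_def intro!: mult_right_mono)
    finally show ?thesis .
  qed
  have f_int: "integrable M (f n)" for n
  proof (rule Bochner_Integration.integrable_bound[OF int])
    show "f n \<in> borel_measurable M" unfolding f_def by measurable
    show "AE x in M. norm (f n x) \<le> norm (exp (d * \<bar>x\<bar>))"
      using bound[of "{n}"] by (auto simp: norm_f)
  qed
  have ptw: "(\<lambda>n. f n x) sums exp (w * of_real x)" for x
  proof -
    have "(\<lambda>n. exp (\<i> * of_real t * of_real x) * ((h * of_real x) ^ n /\<^sub>R fact n)) sums
        (exp (\<i> * of_real t * of_real x) * exp (h * of_real x))"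
      by (intro sums_mult exp_converges)
    also have "exp (\<i> * of_real t * of_real x) * exp (h * of_real x) = exp (w * of_real x)"
      by (simp add: h_def algebra_simps flip: exp_add)
    also have "(\<lambda>n. exp (\<i> * of_real t * of_real x) * ((h * of_real x) ^ n /\<^sub>R fact n)) = (\<lambda>n. f n x)"
      by (simp add: f_def fun_eq_iff power_mult_distrib scaleR_conv_of_real divide_inverse mult_ac)
    finally show ?thesis .
  qed
  have "(\<lambda>N. \<integral>x. (\<Sum>n<N. f n x) \<partial>M) \<longlonglongrightarrow> (\<integral>x. exp (w * of_real x) \<partial>M)"
  proof (rule integral_dominated_convergence[OF _ _ int])
    show "AE x in M. (\<lambda>N. \<Sum>n<N. f n x) \<longlonglongrightarrow> exp (w * of_real x)"
      using ptw by (auto simp: sums_def)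
    show "AE x in M. norm (\<Sum>n<N. f n x) \<le> exp (d * \<bar>x\<bar>)" for N
      by (intro AE_I2 order_trans[OF norm_sum]) (simp add: norm_f bound)
    show "(\<lambda>x. \<Sum>n<N. f n x) \<in> borel_measurable M" for N
      unfolding f_def by measurable
  qed measurable
  also have "(\<lambda>N. \<integral>x. (\<Sum>n<N. f n x) \<partial>M) = (\<lambda>N. \<Sum>n<N. \<integral>x. f n x \<partial>M)"
    using f_int by (intro ext Bochner_Integration.integral_sum) auto
  finally have "(\<lambda>n. \<integral>x. f n x \<partial>M) sums bilateral_mgf M w"
    by (simp add: sums_def bilateral_mgf_def)
  thus ?thesis
    unfolding f_def h_def by simp
qed

text \<open>Each \<open>z\<close> has distance |Re z| from the imaginary axis, so the discs of
  radius \<open>d\<close> centred on that axis cover the strip.\<close>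

lemma (in real_distribution) holomorphic_bilateral_mgf:
  assumes int: "integrable M (\<lambda>x. exp (d * \<bar>x\<bar>))"
  shows "bilateral_mgf M holomorphic_on {z. \<bar>Re z\<bar> < d}"
proof (rule holomorphic_onI)
  fix z assume "z \<in> {z. \<bar>Re z\<bar> < d}"
  hence z: "z \<in> ball (\<i> * of_real (Im z)) d"
    by (simp add: dist_norm norm_minus_commute cmod_def)
  have "bilateral_mgf M holomorphic_on ball (\<i> * of_real (Im z)) d"
    by (rule power_series_holomorphic, rule bilateral_mgf_power_series[OF int])
       (simp add: dist_norm norm_minus_commute)
  thus "bilateral_mgf M field_differentiable at z within {z. \<bar>Re z\<bar> < d}"
    using z holomorphic_on_imp_differentiable_at[of _ "ball (\<i> * of_real (Im z)) d"]
      field_differentiable_at_within by blast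
qed

lemma char_eq_bilateral_mgf: "char M t = bilateral_mgf M (\<i> * of_real t)"
  unfolding char_def bilateral_mgf_def by (simp add: mult_ac)

section \<open>The identity theorem on a strip and on a disc\<close>

lemma open_strip: "open {z. \<bar>Re z\<bar> < d}"
  by (intro open_Collect_less continuous_intros)

lemma connected_strip: "connected {z. \<bar>Re z\<bar> < d}"
proof (rule convex_connected)
  have "{z. \<bar>Re z\<bar> < d} = {z. Re z < d} \<inter> {z. Re z > - d}" by auto
  thus "convex {z. \<bar>Re z\<bar> < d}"
    by (simp add: convex_halfspace_Re_lt convex_halfspace_Re_gt convex_Int)
qed

text \<open>Supplies the accumulation point for the identity theorem, with \<open>c = \<i>\<close>
  on the imaginary and \<open>c = 1\<close> on the real axis.\<close>

lemma islimpt_segment_complex: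
  assumes "r > (0::real)" and "cmod c = 1"
  shows "0 islimpt (\<lambda>t. c * complex_of_real t) ` {-r<..<r}"
proof (rule islimpt_approachable[THEN iffD2], intro allI impI)
  fix e :: real assume e: "e > 0"
  have "c * of_real (min r e / 2) \<in> (\<lambda>t. c * complex_of_real t) ` {-r<..<r}"
    using assms e by (intro imageI) auto
  thus "\<exists>x'\<in>(\<lambda>t. c * complex_of_real t) ` {-r<..<r}. x' \<noteq> 0 \<and> dist x' 0 < e"
    using assms e by (intro bexI[of _ "c * of_real (min r e / 2)"]) (auto simp: norm_mult)
qed

text \<open>Both transforms are holomorphic on a connected strip and agree on a segment of the
  imaginary axis, hence on the whole strip; Levy's uniqueness theorem then identifies the
  laws.\<close>

lemma real_distribution_eqI_char_near_0:
  assumes "real_distribution M" "real_distribution N"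
    and d: "d > 0" "integrable M (\<lambda>x. exp (d * \<bar>x\<bar>))" "integrable N (\<lambda>x. exp (d * \<bar>x\<bar>))"
    and r: "r > 0" "\<And>t. \<bar>t\<bar> < r \<Longrightarrow> char M t = char N t"
  shows "M = N"
proof (rule Levy_uniqueness)
  show "char M = char N"
  proof
    fix t
    have "bilateral_mgf M (\<i> * of_real t) - bilateral_mgf N (\<i> * of_real t) = 0"
    proof (rule analytic_continuation[of "\<lambda>z. bilateral_mgf M z - bilateral_mgf N z" "{z. \<bar>Re z\<bar> < d}"
        "(\<lambda>t. \<i> * of_real t) ` {-r<..<r}" 0])
      show "(\<lambda>z. bilateral_mgf M z - bilateral_mgf N z) holomorphic_on {z. \<bar>Re z\<bar> < d}"
        using assms by (intro holomorphic_intros real_distribution.holomorphic_bilateral_mgf)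
      show "0 islimpt (\<lambda>t. \<i> * complex_of_real t) ` {-r<..<r}"
        using r by (intro islimpt_segment_complex) auto
    qed (use d r open_strip connected_strip in \<open>auto simp: char_eq_bilateral_mgf[symmetric]\<close>)
    thus "char M t = char N t" by (simp add: char_eq_bilateral_mgf)
  qed
qed (fact assms)+

text \<open>The identity on a real interval extends to a complex disc around 0, which contains a
  segment of the imaginary axis.\<close>

lemma char_from_mgf_power_series:
  fixes a :: "nat \<Rightarrow> real"
  assumes M: "real_distribution M"
    and d: "d > 0" "integrable M (\<lambda>x. exp (d * \<bar>x\<bar>))"
    and r: "r > 0" "\<And>z. \<bar>z\<bar> < r \<Longrightarrow> summable (\<lambda>n. a n * z ^ n)"
    and mgf: "\<forall>\<^sub>F z in nhds 0. (\<integral>x. exp (x * z) \<partial>M) = exp (\<Sum>n. a n * z ^ n)"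
  obtains s where "s > 0"
    "\<And>t. \<bar>t\<bar> < s \<Longrightarrow> char M t = exp (\<Sum>n. of_real (a n) * (\<i> * of_real t) ^ n)"
proof -
  interpret real_distribution M by fact
  obtain q where q: "q > 0" "\<And>z. \<bar>z\<bar> < q \<Longrightarrow> (\<integral>x. exp (x * z) \<partial>M) = exp (\<Sum>n. a n * z ^ n)"
    using mgf unfolding eventually_nhds_metric by (auto simp: dist_norm)
  \<comment> \<open>\<open>d\<close> keeps the disc inside the strip of holomorphy, \<open>r\<close>
    inside the disc of convergence, and \<open>q\<close> keeps its real points where the given
    identity holds.\<close>
  define s where "s = Min {d, r, q}"
  have s: "s > 0" "s \<le> d" "s \<le> r" "s \<le> q" using d r q by (auto simp: s_def)
  define A where "A z = (\<Sum>n. of_real (a n) * z ^ n)" for z :: complex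
  have sum: "summable (\<lambda>n. complex_of_real (a n) * z ^ n)" if "z \<in> ball 0 s" for z
  proof -
    have "norm z < s" using that by (simp add: dist_norm)
    then obtain y where y: "norm z < y" "y < s" using dense by blast
    have "summable (\<lambda>n. complex_of_real (a n) * of_real y ^ n)"
      using r(2)[of y] y s norm_ge_zero[of z]
      by (simp flip: of_real_power of_real_mult add: summable_of_real_iff)
    thus ?thesis
      by (rule powser_inside) (use y norm_ge_zero[of z] in auto)
  qed
  have A: "A holomorphic_on ball 0 s"
    using sum by (intro power_series_holomorphic[where a = "\<lambda>n. of_real (a n)"])
      (auto simp: A_def intro!: summable_sums)
  have eq: "bilateral_mgf M z - exp (A z) = 0" if "z \<in> ball 0 s" for z
  proof (rule analytic_continuation[of "\<lambda>z. bilateral_mgf M z - exp (A z)" "ball 0 s"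
        "(\<lambda>t. 1 * of_real t) ` {-s<..<s}" 0])
    have "bilateral_mgf M holomorphic_on ball 0 s"
      by (rule holomorphic_on_subset[OF holomorphic_bilateral_mgf[OF d(2)]])
         (use s abs_Re_le_cmod in \<open>force intro: le_less_trans\<close>)
    thus "(\<lambda>z. bilateral_mgf M z - exp (A z)) holomorphic_on ball 0 s"
      using A by (intro holomorphic_intros)
    show "0 islimpt (\<lambda>t. 1 * complex_of_real t) ` {-s<..<s}"
      using s by (intro islimpt_segment_complex) auto
    fix z assume "z \<in> (\<lambda>t. 1 * complex_of_real t) ` {-s<..<s}"
    then obtain t where t: "z = of_real t" "\<bar>t\<bar> < s" by auto
    have "bilateral_mgf M z = of_real (\<integral>x. exp (x * t) \<partial>M)"
      unfolding bilateral_mgf_def t(1)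
      by (simp flip: integral_complex_of_real add: exp_of_real mult.commute flip: of_real_mult exp_of_real)
    also have "\<dots> = exp (of_real (\<Sum>n. a n * t ^ n))"
      using q(2)[of t] t s by (simp add: exp_of_real)
    also have "of_real (\<Sum>n. a n * t ^ n) = A z"
      unfolding A_def t(1) using r(2)[of t] t(2) s by (subst suminf_of_real) auto
    finally show "bilateral_mgf M z - exp (A z) = 0" by simp
  qed (use that s in auto)
  show ?thesis
  proof (rule that[OF s(1)])
    fix t :: real assume "\<bar>t\<bar> < s"
    thus "char M t = exp (\<Sum>n. of_real (a n) * (\<i> * of_real t) ^ n)"
      using eq[of "\<i> * of_real t"] by (simp add: char_eq_bilateral_mgf A_def norm_mult)
  qed
qed

section \<open>Weighted series of independent random variables\<close>

context prob_space
begin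

text \<open>The bound is local because the moment generating function of a Laplace variable exists
  only for |z| < 1. The property passes to weighted sums of independent variables and to almost sure
  limits, so it survives both summations of the double series.\<close>

definition locally_subgaussian :: "real \<Rightarrow> real \<Rightarrow> ('a \<Rightarrow> real) \<Rightarrow> bool" where
  "locally_subgaussian d C X \<longleftrightarrow> X \<in> borel_measurable M \<and>
     (\<forall>z. \<bar>z\<bar> \<le> d \<longrightarrow> integrable M (\<lambda>\<omega>. exp (z * X \<omega>)) \<and> expectation (\<lambda>\<omega>. exp (z * X \<omega>)) \<le> exp (C * z\<^sup>2))"

lemma locally_subgaussian_mono:
  "locally_subgaussian d C X \<Longrightarrow> C \<le> D \<Longrightarrow> locally_subgaussian d D X"
  unfolding locally_subgaussian_def
  by (meson exp_le_cancel_iff mult_right_mono order_trans zero_le_power2)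

lemma locally_subgaussian_sum:
  fixes I :: "'i set"
  assumes I: "finite I" and ind: "indep_vars (\<lambda>_. borel) X I"
    and X: "\<And>i. i \<in> I \<Longrightarrow> locally_subgaussian d C (X i)" and w: "\<And>i. i \<in> I \<Longrightarrow> \<bar>w i\<bar> \<le> 1"
  shows "locally_subgaussian d (C * (\<Sum>i\<in>I. (w i)\<^sup>2)) (\<lambda>\<omega>. \<Sum>i\<in>I. w i * X i \<omega>)"
  unfolding locally_subgaussian_def
proof (intro conjI allI impI)
  have [measurable]: "X i \<in> borel_measurable M" if "i \<in> I" for i
    using X[OF that] by (simp add: locally_subgaussian_def)
  show "(\<lambda>\<omega>. \<Sum>i\<in>I. w i * X i \<omega>) \<in> borel_measurable M" by measurable
  fix z :: real assume z: "\<bar>z\<bar> \<le> d"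
  have zw: "\<bar>z * w i\<bar> \<le> d" if "i \<in> I" for i
    using w[OF that] z mult_mono[of "\<bar>z\<bar>" d "\<bar>w i\<bar>" 1] by (simp add: abs_mult)
  have int: "integrable M (\<lambda>\<omega>. exp (z * w i * X i \<omega>))"
    and le: "expectation (\<lambda>\<omega>. exp (z * w i * X i \<omega>)) \<le> exp (C * (z * w i)\<^sup>2)" if "i \<in> I" for i
    using X[OF that] zw[OF that] unfolding locally_subgaussian_def by blast+
  have ind': "indep_vars (\<lambda>_. borel) (\<lambda>i \<omega>. exp (z * w i * X i \<omega>)) I"
    by (rule indep_vars_compose2[OF ind]) auto
  have prod: "exp (z * (\<Sum>i\<in>I. w i * X i \<omega>)) = (\<Prod>i\<in>I. exp (z * w i * X i \<omega>))" for \<omega>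
    using I by (simp add: exp_sum[symmetric] sum_distrib_left mult.assoc)
  show "integrable M (\<lambda>\<omega>. exp (z * (\<Sum>i\<in>I. w i * X i \<omega>)))"
    unfolding prod by (rule indep_vars_integrable[OF I ind' int])
  have "expectation (\<lambda>\<omega>. exp (z * (\<Sum>i\<in>I. w i * X i \<omega>))) = (\<Prod>i\<in>I. expectation (\<lambda>\<omega>. exp (z * w i * X i \<omega>)))"
    unfolding prod by (rule indep_vars_lebesgue_integral[OF I ind' int])
  also have "\<dots> \<le> (\<Prod>i\<in>I. exp (C * (z * w i)\<^sup>2))"
    using le by (intro prod_mono) (auto intro!: Bochner_Integration.integral_nonneg)
  also have "\<dots> = exp (C * (\<Sum>i\<in>I. (w i)\<^sup>2) * z\<^sup>2)"
    using I by (simp add: exp_sum[symmetric] sum_distrib_left sum_distrib_right power_mult_distrib mult_ac)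
  finally show "expectation (\<lambda>\<omega>. exp (z * (\<Sum>i\<in>I. w i * X i \<omega>))) \<le> exp (C * (\<Sum>i\<in>I. (w i)\<^sup>2) * z\<^sup>2)" .
qed

text \<open>Fatou's lemma for exp (z X_n), whose expectations share the bound exp (C z^2).\<close>

lemma locally_subgaussian_limit:
  assumes X: "\<And>n. locally_subgaussian d C (X n)" and Y: "Y \<in> borel_measurable M"
    and lim: "AE \<omega> in M. (\<lambda>n. X n \<omega>) \<longlonglongrightarrow> Y \<omega>"
  shows "locally_subgaussian d C Y"
  unfolding locally_subgaussian_def
proof (intro conjI allI impI)
  fix z :: real assume z: "\<bar>z\<bar> \<le> d"
  note [measurable] = Y
  have [measurable]: "X n \<in> borel_measurable M" for n
    using X by (simp add: locally_subgaussian_def)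
  have "(\<integral>\<^sup>+\<omega>. ennreal (exp (z * Y \<omega>)) \<partial>M) = (\<integral>\<^sup>+\<omega>. liminf (\<lambda>n. ennreal (exp (z * X n \<omega>))) \<partial>M)"
  proof (rule nn_integral_cong_AE)
    show "AE \<omega> in M. ennreal (exp (z * Y \<omega>)) = liminf (\<lambda>n. ennreal (exp (z * X n \<omega>)))"
      using lim
    proof eventually_elim
      case (elim \<omega>)
      have "(\<lambda>n. ennreal (exp (z * X n \<omega>))) \<longlonglongrightarrow> ennreal (exp (z * Y \<omega>))"
        using elim by (intro tendsto_ennrealI tendsto_intros)
      from lim_imp_Liminf[OF _ this] show ?case by simp
    qed
  qed
  also have "\<dots> \<le> liminf (\<lambda>n. \<integral>\<^sup>+\<omega>. ennreal (exp (z * X n \<omega>)) \<partial>M)"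
    by (rule nn_integral_liminf) measurable
  also have "\<dots> \<le> liminf (\<lambda>n. ennreal (exp (C * z\<^sup>2)))"
  proof (intro Liminf_mono always_eventually allI)
    fix n
    have "(\<integral>\<^sup>+\<omega>. ennreal (exp (z * X n \<omega>)) \<partial>M) = ennreal (expectation (\<lambda>\<omega>. exp (z * X n \<omega>)))"
      using X[of n] z by (intro nn_integral_eq_integral) (auto simp: locally_subgaussian_def)
    thus "(\<integral>\<^sup>+\<omega>. ennreal (exp (z * X n \<omega>)) \<partial>M) \<le> ennreal (exp (C * z\<^sup>2))"
      using X[of n] z by (simp add: locally_subgaussian_def ennreal_leI)
  qed
  also have "\<dots> = ennreal (exp (C * z\<^sup>2))"
    by (simp add: Liminf_const)
  finally have le: "(\<integral>\<^sup>+\<omega>. ennreal (exp (z * Y \<omega>)) \<partial>M) \<le> ennreal (exp (C * z\<^sup>2))" .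
  show int: "integrable M (\<lambda>\<omega>. exp (z * Y \<omega>))"
    by (rule integrableI_nonneg) (use le in \<open>auto intro: le_less_trans\<close>)
  have "ennreal (expectation (\<lambda>\<omega>. exp (z * Y \<omega>))) \<le> ennreal (exp (C * z\<^sup>2))"
    using le by (subst nn_integral_eq_integral[OF int, symmetric]) auto
  thus "expectation (\<lambda>\<omega>. exp (z * Y \<omega>)) \<le> exp (C * z\<^sup>2)"
    by (simp add: ennreal_le_iff)
qed fact

text \<open>One term of the exponential series gives (z |x|)^n / n! \<le> exp (z x) + exp (- z x).
  The parameter \<open>z\<close> stays free so that it can be adapted to the number of
  summands.\<close>

lemma locally_subgaussian_nn_moment:
  assumes X: "locally_subgaussian d C X" and z: "0 < z" "z \<le> d"
  shows "(\<integral>\<^sup>+\<omega>. ennreal (\<bar>X \<omega>\<bar> ^ n) \<partial>M) \<le> ennreal (fact n * (2 * exp (C * z\<^sup>2)) / z ^ n)"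
proof -
  have [measurable]: "X \<in> borel_measurable M"
    using X by (simp add: locally_subgaussian_def)
  have int: "integrable M (\<lambda>\<omega>. exp (z * X \<omega>))" "integrable M (\<lambda>\<omega>. exp (- z * X \<omega>))"
    and le: "expectation (\<lambda>\<omega>. exp (z * X \<omega>)) \<le> exp (C * z\<^sup>2)"
      "expectation (\<lambda>\<omega>. exp (- z * X \<omega>)) \<le> exp (C * (- z)\<^sup>2)"
    using X[unfolded locally_subgaussian_def, THEN conjunct2, rule_format, of z]
      X[unfolded locally_subgaussian_def, THEN conjunct2, rule_format, of "- z"] z by auto
  have bd: "\<bar>x\<bar> ^ n \<le> fact n / z ^ n * (exp (z * x) + exp (- z * x))" for x
  proof -
    have "(z * \<bar>x\<bar>) ^ n /\<^sub>R fact n \<le> exp (z * \<bar>x\<bar>)"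
      using sum_le_suminf[OF summable_exp_generic[of "z * \<bar>x\<bar>"], of "{n}"] z by (simp add: exp_def)
    also have "\<dots> \<le> exp (z * x) + exp (- z * x)"
      by (cases "x \<ge> 0") auto
    finally show ?thesis using z by (simp add: field_simps)
  qed
  have "(\<integral>\<^sup>+\<omega>. ennreal (\<bar>X \<omega>\<bar> ^ n) \<partial>M) \<le>
      (\<integral>\<^sup>+\<omega>. ennreal (fact n / z ^ n * (exp (z * X \<omega>) + exp (- z * X \<omega>))) \<partial>M)"
    by (intro nn_integral_mono ennreal_leI bd)
  also have "\<dots> = ennreal (expectation (\<lambda>\<omega>. fact n / z ^ n * (exp (z * X \<omega>) + exp (- z * X \<omega>))))"
    using z int by (intro nn_integral_eq_integral) (auto intro!: AE_I2 add_nonneg_nonneg)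
  also have "expectation (\<lambda>\<omega>. fact n / z ^ n * (exp (z * X \<omega>) + exp (- z * X \<omega>))) =
      fact n / z ^ n * (expectation (\<lambda>\<omega>. exp (z * X \<omega>)) + expectation (\<lambda>\<omega>. exp (- z * X \<omega>)))"
    using int by (simp only: Bochner_Integration.integral_mult_right_zero Bochner_Integration.integral_add)
  also have "\<dots> \<le> fact n / z ^ n * (exp (C * z\<^sup>2) + exp (C * z\<^sup>2))"
    using le z by (intro mult_left_mono add_mono) auto
  finally show ?thesis by (simp add: mult_ac ennreal_leI)
qed

lemma AE_summable_nn_integral:
  fixes f :: "nat \<Rightarrow> 'a \<Rightarrow> real"
  assumes [measurable]: "\<And>n. f n \<in> borel_measurable M" and f: "\<And>n \<omega>. 0 \<le> f n \<omega>"
    and le: "\<And>n. (\<integral>\<^sup>+\<omega>. ennreal (f n \<omega>) \<partial>M) \<le> ennreal (b n)" and b: "\<And>n. 0 \<le> b n" "summable b"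
  shows "AE \<omega> in M. summable (\<lambda>n. f n \<omega>)"
proof -
  have "(\<integral>\<^sup>+\<omega>. (\<Sum>n. ennreal (f n \<omega>)) \<partial>M) = (\<Sum>n. \<integral>\<^sup>+\<omega>. ennreal (f n \<omega>) \<partial>M)"
    by (rule nn_integral_suminf) measurable
  also have "\<dots> \<le> (\<Sum>n. ennreal (b n))"
    using le by (intro suminf_le) auto
  also have "\<dots> = ennreal (suminf b)"
    using b by (intro suminf_ennreal2) auto
  finally have "(\<integral>\<^sup>+\<omega>. (\<Sum>n. ennreal (f n \<omega>)) \<partial>M) \<noteq> \<infinity>"
    by (auto simp: top_unique)
  hence "AE \<omega> in M. (\<Sum>n. ennreal (f n \<omega>)) \<noteq> \<infinity>"
    by (intro nn_integral_PInf_AE) measurable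
  thus ?thesis
    by eventually_elim (intro summable_suminf_not_top, auto simp: f)
qed

text \<open>Only the local bound is required of the summands, so the lemma serves the Laplace
  variables within a row and then the row sums themselves. The conditions on \<open>w\<close> suit
  both 1 / (2 n + 1) and 1 / (n + 1).\<close>

lemma AE_summable_weighted_indep:
  fixes X :: "nat \<Rightarrow> 'a \<Rightarrow> real"
  assumes ind: "indep_vars (\<lambda>_. borel) X UNIV"
    and X: "\<And>n. locally_subgaussian d C (X n)" and d: "d > 0"
    and w: "\<And>n. \<bar>w n\<bar> \<le> 1 / real (Suc n)" "\<And>n. \<bar>w n - w (Suc n)\<bar> \<le> 2 / (real (Suc n))\<^sup>2"
  shows "AE \<omega> in M. summable (\<lambda>n. w n * X n \<omega>)"
proof -
  have [measurable]: "X n \<in> borel_measurable M" for n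
    using X by (simp add: locally_subgaussian_def)
  define T where "T n \<omega> = (\<Sum>k<n. X k \<omega>)" for n \<omega>
  have [measurable]: "T n \<in> borel_measurable M" for n
    unfolding T_def by measurable
  have T: "locally_subgaussian d (C * real n) (T n)" for n
    using locally_subgaussian_sum[of "{..<n}" X d C "\<lambda>_. 1"] X indep_vars_subset[OF ind, of "{..<n}"]
    by (simp add: T_def[abs_def])
  define K where "K = 2 * exp (C * d\<^sup>2)"
  have moment: "(\<integral>\<^sup>+\<omega>. ennreal (\<bar>T (Suc n) \<omega>\<bar> ^ m) \<partial>M) \<le> ennreal (fact m * K / d ^ m * sqrt (real (Suc n)) ^ m)" for n m
  proof -
    \<comment> \<open>This scaling makes \<open>C * real (Suc n) * ?z\<^sup>2\<close> independent of
      \<open>n\<close>, so the absolute moment of order \<open>m\<close> is O(n^(m/2)).\<close>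
    let ?z = "d / sqrt (real (Suc n))"
    have z: "0 < ?z" "?z \<le> d"
      using d by (auto simp: divide_le_eq)
    have "C * real (Suc n) * ?z\<^sup>2 = C * d\<^sup>2"
      by (simp add: power_divide)
    with locally_subgaussian_nn_moment[OF T z, of "Suc n" m] show ?thesis
      by (simp add: K_def power_divide)
  qed
  have K: "K \<ge> 0" by (simp add: K_def)
  have "AE \<omega> in M. summable (\<lambda>n. \<bar>(w n - w (Suc n)) * T (Suc n) \<omega>\<bar>)"
  \<comment> \<open>First moments of order sqrt n against weight differences of order 1 / n^2 leave
    a convergent series of terms n^(-3/2).\<close>
  proof (rule AE_summable_nn_integral[where b = "\<lambda>n. 2 * (K / d) * real (Suc n) powr (-3/2)"])
    show "(\<integral>\<^sup>+\<omega>. ennreal \<bar>(w n - w (Suc n)) * T (Suc n) \<omega>\<bar> \<partial>M) \<le> ennreal (2 * (K / d) * real (Suc n) powr (-3/2))" for n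
    proof -
      have "(\<integral>\<^sup>+\<omega>. ennreal \<bar>(w n - w (Suc n)) * T (Suc n) \<omega>\<bar> \<partial>M) =
          (\<integral>\<^sup>+\<omega>. ennreal \<bar>w n - w (Suc n)\<bar> * ennreal (\<bar>T (Suc n) \<omega>\<bar> ^ 1) \<partial>M)"
        by (simp add: abs_mult ennreal_mult)
      also have "\<dots> = ennreal \<bar>w n - w (Suc n)\<bar> * (\<integral>\<^sup>+\<omega>. ennreal (\<bar>T (Suc n) \<omega>\<bar> ^ 1) \<partial>M)"
        by (rule nn_integral_cmult) measurable
      also have "\<dots> \<le> ennreal (2 / (real (Suc n))\<^sup>2) * ennreal (fact 1 * K / d ^ 1 * sqrt (real (Suc n)) ^ 1)"
        by (intro mult_mono ennreal_leI w moment) auto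
      also have "\<dots> = ennreal (2 / (real (Suc n))\<^sup>2 * (fact 1 * K / d ^ 1 * sqrt (real (Suc n)) ^ 1))"
        using d K by (intro ennreal_mult[symmetric]) auto
      also have "2 / (real (Suc n))\<^sup>2 * (fact 1 * K / d ^ 1 * sqrt (real (Suc n)) ^ 1) =
          2 * (K / d) * (sqrt (real (Suc n)) / (real (Suc n))\<^sup>2)"
        by (simp add: mult_ac)
      also have "sqrt (real (Suc n)) / (real (Suc n))\<^sup>2 = real (Suc n) powr (1/2) / real (Suc n) powr 2"
        by (simp add: powr_half_sqrt)
      also have "\<dots> = real (Suc n) powr (-3/2)"
        by (subst powr_diff[symmetric]) simp
      finally show ?thesis .
    qed
    have "summable (\<lambda>n. real n powr (-3/2))"
      by (subst summable_real_powr_iff) auto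
    hence "summable (\<lambda>n. real (Suc n) powr (-3/2))"
      by (subst summable_Suc_iff)
    thus "summable (\<lambda>n. 2 * (K / d) * real (Suc n) powr (-3/2))"
      by (rule summable_mult)
  qed (use d K in auto)
  moreover have "AE \<omega> in M. summable (\<lambda>n. (\<bar>T (Suc n) \<omega>\<bar> / real (Suc n)) ^ 4)"
  \<comment> \<open>The fourth moment of T_n / n is O(1 / n^2), hence summable, where the second
    would only give O(1 / n). Almost sure summability then forces T_n / n to 0.\<close>
  proof (rule AE_summable_nn_integral[where b = "\<lambda>n. fact 4 * K / d ^ 4 * (1 / (real (Suc n))\<^sup>2)"])
    show "(\<integral>\<^sup>+\<omega>. ennreal ((\<bar>T (Suc n) \<omega>\<bar> / real (Suc n)) ^ 4) \<partial>M) \<le>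
        ennreal (fact 4 * K / d ^ 4 * (1 / (real (Suc n))\<^sup>2))" for n
    proof -
      have "(\<integral>\<^sup>+\<omega>. ennreal ((\<bar>T (Suc n) \<omega>\<bar> / real (Suc n)) ^ 4) \<partial>M) =
          (\<integral>\<^sup>+\<omega>. ennreal (1 / real (Suc n) ^ 4) * ennreal (\<bar>T (Suc n) \<omega>\<bar> ^ 4) \<partial>M)"
        by (intro nn_integral_cong, subst ennreal_mult[symmetric]) (auto simp: power_divide)
      also have "\<dots> = ennreal (1 / real (Suc n) ^ 4) * (\<integral>\<^sup>+\<omega>. ennreal (\<bar>T (Suc n) \<omega>\<bar> ^ 4) \<partial>M)"
        by (rule nn_integral_cmult) measurable
      also have "\<dots> \<le> ennreal (1 / real (Suc n) ^ 4) * ennreal (fact 4 * K / d ^ 4 * sqrt (real (Suc n)) ^ 4)"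
        by (intro mult_left_mono moment) auto
      also have "\<dots> = ennreal (1 / real (Suc n) ^ 4 * (fact 4 * K / d ^ 4 * sqrt (real (Suc n)) ^ 4))"
        using d K by (intro ennreal_mult[symmetric]) auto
      also have "sqrt (real (Suc n)) ^ 4 = (real (Suc n))\<^sup>2"
      proof -
        have "sqrt (real (Suc n)) ^ 4 = ((sqrt (real (Suc n)))\<^sup>2)\<^sup>2"
          by (simp only: power_mult[symmetric]) simp
        thus ?thesis by simp
      qed
      also have "1 / real (Suc n) ^ 4 * (fact 4 * K / d ^ 4 * (real (Suc n))\<^sup>2) =
          fact 4 * K / d ^ 4 * (1 / (real (Suc n))\<^sup>2)"
        by (simp add: divide_simps power2_eq_square power4_eq_xxxx)
      finally show ?thesis .
    qed
    show "summable (\<lambda>n. fact 4 * K / d ^ 4 * (1 / (real (Suc n))\<^sup>2))"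
      by (intro summable_mult summable_recip_squares)
  qed (use d K in auto)
  ultimately show ?thesis
  proof eventually_elim
    case (elim \<omega>)
    \<comment> \<open>Summation by parts: the boundary term tends to 0 and the remaining series
      converges absolutely.\<close>
    have parts: "(\<Sum>k<n. w k * X k \<omega>) = w n * T n \<omega> + (\<Sum>k<n. (w k - w (Suc k)) * T (Suc k) \<omega>)" for n
      by (induction n) (simp_all add: T_def algebra_simps)
    have conv: "convergent (\<lambda>n. \<Sum>k<n. (w k - w (Suc k)) * T (Suc k) \<omega>)"
      using elim(1) by (simp add: summable_rabs_cancel flip: summable_iff_convergent)
    have "(\<lambda>n. (\<bar>T (Suc n) \<omega>\<bar> / real (Suc n)) ^ 4) \<longlonglongrightarrow> 0"
      using elim(2) by (rule summable_LIMSEQ_zero)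
    hence "(\<lambda>n. \<bar>T (Suc n) \<omega>\<bar> / real (Suc n)) \<longlonglongrightarrow> 0"
      by (subst (asm) power_tendsto_0_iff) auto
    hence "(\<lambda>n. w (Suc n) * T (Suc n) \<omega>) \<longlonglongrightarrow> 0"
    proof (rule Lim_null_comparison[rotated], intro always_eventually allI)
      fix n
      have "\<bar>w (Suc n)\<bar> \<le> 1 / real (Suc n)"
        using w(1)[of "Suc n"] by (rule order_trans) (simp add: field_simps)
      hence "\<bar>w (Suc n)\<bar> * \<bar>T (Suc n) \<omega>\<bar> \<le> 1 / real (Suc n) * \<bar>T (Suc n) \<omega>\<bar>"
        by (rule mult_right_mono) auto
      thus "norm (w (Suc n) * T (Suc n) \<omega>) \<le> \<bar>T (Suc n) \<omega>\<bar> / real (Suc n)"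
        by (simp add: abs_mult)
    qed
    hence "(\<lambda>n. w n * T n \<omega>) \<longlonglongrightarrow> 0"
      by (rule LIMSEQ_imp_Suc)
    hence "convergent (\<lambda>n. \<Sum>k<n. w k * X k \<omega>)"
      unfolding parts using conv by (intro convergent_add) (auto simp: convergent_def)
    thus ?case by (simp add: summable_iff_convergent)
  qed
qed

text \<open>All partial sums satisfy the bound with the constant of the full series, so it survives
  in the limit. This feeds the second summation and, at the end, gives the exponential
  moments.\<close>

lemma locally_subgaussian_suminf:
  fixes X :: "nat \<Rightarrow> 'a \<Rightarrow> real"
  assumes ind: "indep_vars (\<lambda>_. borel) X UNIV"
    and X: "\<And>n. locally_subgaussian d C (X n)" and C: "0 \<le> C"
    and w: "\<And>n. \<bar>w n\<bar> \<le> 1" "summable (\<lambda>n. (w n)\<^sup>2)"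
    and sum: "AE \<omega> in M. summable (\<lambda>n. w n * X n \<omega>)"
  shows "locally_subgaussian d (C * (\<Sum>n. (w n)\<^sup>2)) (\<lambda>\<omega>. \<Sum>n. w n * X n \<omega>)"
proof (rule locally_subgaussian_limit)
  have [measurable]: "X n \<in> borel_measurable M" for n
    using X by (simp add: locally_subgaussian_def)
  show "locally_subgaussian d (C * (\<Sum>n. (w n)\<^sup>2)) (\<lambda>\<omega>. \<Sum>k<n. w k * X k \<omega>)" for n
  proof (rule locally_subgaussian_mono)
    show "locally_subgaussian d (C * (\<Sum>k<n. (w k)\<^sup>2)) (\<lambda>\<omega>. \<Sum>k<n. w k * X k \<omega>)"
      by (rule locally_subgaussian_sum) (use X w indep_vars_subset[OF ind] in auto)
    show "C * (\<Sum>k<n. (w k)\<^sup>2) \<le> C * (\<Sum>n. (w n)\<^sup>2)"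
      using w C by (intro mult_left_mono sum_le_suminf) auto
  qed
  show "(\<lambda>\<omega>. \<Sum>n. w n * X n \<omega>) \<in> borel_measurable M" by measurable
  show "AE \<omega> in M. (\<lambda>n. \<Sum>k<n. w k * X k \<omega>) \<longlonglongrightarrow> (\<Sum>n. w n * X n \<omega>)"
    using sum by eventually_elim (rule summable_LIMSEQ)
qed

text \<open>Independence factors the characteristic functions of the partial sums; their limit is
  taken by dominated convergence, the integrands having modulus 1.\<close>

lemma char_distr_weighted_suminf:
  fixes X :: "nat \<Rightarrow> 'a \<Rightarrow> real"
  assumes ind: "indep_vars (\<lambda>_. borel) X UNIV"
    and sum: "AE \<omega> in M. summable (\<lambda>n. w n * X n \<omega>)"
  shows "(\<lambda>N. \<Prod>n<N. char (distr M borel (X n)) (w n * t)) \<longlonglongrightarrow>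
    char (distr M borel (\<lambda>\<omega>. \<Sum>n. w n * X n \<omega>)) t"
proof -
  have [measurable]: "X n \<in> borel_measurable M" for n
    using ind by (simp add: indep_vars_def)
  have "(\<lambda>N. expectation (\<lambda>\<omega>. iexp (t * (\<Sum>n<N. w n * X n \<omega>)))) \<longlonglongrightarrow> expectation (\<lambda>\<omega>. iexp (t * (\<Sum>n. w n * X n \<omega>)))"
  proof (rule integral_dominated_convergence[where w = "\<lambda>_. 1"])
    show "AE \<omega> in M. (\<lambda>N. iexp (t * (\<Sum>n<N. w n * X n \<omega>))) \<longlonglongrightarrow> iexp (t * (\<Sum>n. w n * X n \<omega>))"
      using sum by eventually_elim (intro tendsto_intros summable_LIMSEQ)
  qed auto
  moreover have "expectation (\<lambda>\<omega>. iexp (t * (\<Sum>n<N. w n * X n \<omega>))) = (\<Prod>n<N. char (distr M borel (X n)) (w n * t))" for N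
  proof -
    have "indep_vars (\<lambda>_. borel) (\<lambda>n \<omega>. w n * X n \<omega>) {..<N}"
      by (rule indep_vars_compose2[OF indep_vars_subset[OF ind]]) auto
    from char_distr_sum[OF this, of t] show ?thesis
      by (simp add: char_def integral_distr mult_ac)
  qed
  moreover have "expectation (\<lambda>\<omega>. iexp (t * (\<Sum>n. w n * X n \<omega>))) = char (distr M borel (\<lambda>\<omega>. \<Sum>n. w n * X n \<omega>)) t"
    by (simp add: char_def integral_distr)
  ultimately show ?thesis by simp
qed

end

section \<open>Laplace variables\<close>

lemma exp_half_line_integral:
  fixes a :: complex
  assumes a: "Re a < 0"
  shows "integrable lborel (\<lambda>x. indicator {0<..} x *\<^sub>R exp (a * of_real x))" (is ?int)
    and "(\<integral>x. indicator {0<..} x *\<^sub>R exp (a * of_real x) \<partial>lborel) = - 1 / a" (is ?eq)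
proof -
  have "set_integrable lborel {0<..} (\<lambda>x. exp (- (x * (- Re a))))"
    using a by (intro integrable_I0i_exp_mscale) auto
  thus ?int
    unfolding set_integrable_def
    by (rule Bochner_Integration.integrable_bound) (auto split: split_indicator simp: mult.commute)
  moreover have Ioi: "einterval 0 \<infinity> = {0<..}"
    by (auto simp: einterval_def)
  ultimately have set: "set_integrable lborel (einterval 0 \<infinity>) (\<lambda>x. exp (a * of_real x))"
    by (simp add: set_integrable_def)
  have a0: "a \<noteq> 0" using a by auto
  have "(LBINT x=0..\<infinity>. exp (a * of_real x)) = 0 - 1 / a"
  proof (rule interval_integral_FTC_integrable[where F = "\<lambda>x. exp (a * of_real x) / a"])
    show "((\<lambda>x. exp (a * of_real x) / a) has_vector_derivative exp (a * of_real x)) (at x)" for x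
    proof -
      have "((\<lambda>z. exp (a * z) / a) has_field_derivative exp (a * of_real x)) (at (of_real x))"
        using a0 by (auto intro!: derivative_eq_intros)
      thus ?thesis by (rule has_vector_derivative_real_field)
    qed
    have "((\<lambda>x::real. exp (a * of_real x) / a) \<longlongrightarrow> exp (a * of_real 0) / a) (at_right 0)"
      by (intro tendsto_intros) (use a0 in auto)
    thus "(((\<lambda>x. exp (a * of_real x) / a) \<circ> real_of_ereal) \<longlongrightarrow> 1 / a) (at_right 0)"
      unfolding zero_ereal_def ereal_tendsto_simps1 by simp
    have "((\<lambda>x::real. exp (Re a * x) / cmod a) \<longlongrightarrow> 0 / cmod a) at_top"
      using a a0
      by (intro tendsto_divide tendsto_const filterlim_compose[OF exp_at_bot]
          filterlim_tendsto_neg_mult_at_bot[OF tendsto_const] filterlim_ident) auto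
    hence "((\<lambda>x::real. norm (exp (a * of_real x) / a)) \<longlongrightarrow> 0) at_top"
      by (simp add: norm_divide)
    hence "((\<lambda>x::real. exp (a * of_real x) / a) \<longlongrightarrow> 0) at_top"
      by (rule tendsto_norm_zero_cancel)
    thus "(((\<lambda>x. exp (a * of_real x) / a) \<circ> real_of_ereal) \<longlongrightarrow> 0) (at_left \<infinity>)"
      by (simp add: ereal_tendsto_simps1)
  qed (use set in auto)
  thus ?eq
    by (simp add: interval_lebesgue_integral_def set_lebesgue_integral_def Ioi)
qed

text \<open>The two half lines contribute exponentials of rates z - 1 and - z - 1, the latter after
  a reflection; their integrals 1 / (1 - z) and 1 / (1 + z) have mean 1 / (1 - z^2).\<close>

lemma laplace_integral:
  fixes z :: complex
  assumes z: "\<bar>Re z\<bar> < 1"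
  shows "integrable lborel (\<lambda>x. laplace_density x *\<^sub>R exp (z * of_real x))"
    and "(\<integral>x. laplace_density x *\<^sub>R exp (z * of_real x) \<partial>lborel) = 1 / (1 - z\<^sup>2)"
proof -
  define f where "f a x = indicator {0<..} x *\<^sub>R exp (a * complex_of_real x)" for a x
  have I: "has_bochner_integral lborel (f a) (- 1 / a)" if "Re a < 0" for a
    unfolding f_def using exp_half_line_integral[OF that] by (simp add: has_bochner_integral_iff)
  have z1: "Re (z - 1) < 0" and z2: "Re (- z - 1) < 0" using z by auto
  have "has_bochner_integral lborel (\<lambda>x. f (- z - 1) (0 + (- 1) * x)) ((- 1 / (- z - 1)) /\<^sub>R \<bar>- 1\<bar>)"
    by (rule lborel_has_bochner_integral_real_affine_iff[THEN iffD1]) (use I[OF z2] in auto)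
  hence "has_bochner_integral lborel (\<lambda>x. (1/2) *\<^sub>R (f (z - 1) x + f (- z - 1) (- x)))
      ((1/2) *\<^sub>R (- 1 / (z - 1) + - 1 / (- z - 1)))"
    by (intro has_bochner_integral_scaleR_right has_bochner_integral_add I[OF z1]) auto
  moreover have "(1/2) *\<^sub>R (- 1 / (z - 1) + - 1 / (- z - 1)) = 1 / (1 - z\<^sup>2)"
  proof -
    have nz: "w \<noteq> 0" if "Re w < 0" for w using that by auto
    have "z - 1 \<noteq> 0" "- z - 1 \<noteq> 0" by (rule nz[OF z1], rule nz[OF z2])
    moreover have "1 - z\<^sup>2 = (z - 1) * (- z - 1)" by (simp add: power2_eq_square algebra_simps)
    moreover have "- 1 / a + - 1 / b = - (a + b) / (a * b)" if "a \<noteq> 0" "b \<noteq> 0" for a b :: complex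
      using that by (simp add: divide_simps)
    ultimately show ?thesis by (simp add: scaleR_conv_of_real)
  qed
  ultimately have hb: "has_bochner_integral lborel (\<lambda>x. (1/2) *\<^sub>R (f (z - 1) x + f (- z - 1) (- x))) (1 / (1 - z\<^sup>2))"
    by (simp only:)
  \<comment> \<open>The point 0 lies in neither open half line: there the left side is 0 and the
    right side 1/2.\<close>
  have ae: "AE x in lborel. (1/2) *\<^sub>R (f (z - 1) x + f (- z - 1) (- x)) = laplace_density x *\<^sub>R exp (z * of_real x)"
  proof -
    have e: "exp ((z - 1) * of_real x) = of_real (exp (- x)) * exp (z * of_real x)"
      "exp ((- z - 1) * of_real (- x)) = of_real (exp x) * exp (z * of_real x)" for x
      unfolding exp_of_real[symmetric] exp_add[symmetric] by (simp_all add: algebra_simps)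
    have "(1/2) *\<^sub>R (f (z - 1) x + f (- z - 1) (- x)) = laplace_density x *\<^sub>R exp (z * of_real x)" if "x \<noteq> 0" for x
    proof (cases "x > 0")
      case True
      thus ?thesis unfolding f_def e by (simp add: laplace_density_def scaleR_conv_of_real)
    next
      case False
      with that have "x < 0" by simp
      thus ?thesis unfolding f_def e by (simp add: laplace_density_def scaleR_conv_of_real)
    qed
    thus ?thesis
      using AE_lborel_singleton[of 0] by (rule eventually_mono[rotated])
  qed
  have "has_bochner_integral lborel (\<lambda>x. laplace_density x *\<^sub>R exp (z * of_real x)) (1 / (1 - z\<^sup>2))"
  proof (rule has_bochner_integral_cong_AE[OF _ _ ae, THEN iffD1, OF _ _ hb])
    show "(\<lambda>x. (1/2) *\<^sub>R (f (z - 1) x + f (- z - 1) (- x))) \<in> borel_measurable lborel"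
      using hb by (auto simp: has_bochner_integral_iff)
    show "(\<lambda>x. laplace_density x *\<^sub>R exp (z * of_real x)) \<in> borel_measurable lborel"
      unfolding laplace_density_def by measurable
  qed
  thus "integrable lborel (\<lambda>x. laplace_density x *\<^sub>R exp (z * of_real x))"
    "(\<integral>x. laplace_density x *\<^sub>R exp (z * of_real x) \<partial>lborel) = 1 / (1 - z\<^sup>2)"
    by (auto simp: has_bochner_integral_iff)
qed

text \<open>For these \<open>u\<close>, (1 - u) (1 + 2 u) = 1 + u (1 - 2 u) \<ge> 1. With
  \<open>u = z^2\<close> this bounds the Laplace moment generating function.\<close>

lemma exp_bound_inverse_one_minus:
  fixes u :: real
  assumes "0 \<le> u" "u \<le> 1/2"
  shows "1 / (1 - u) \<le> exp (2 * u)"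
proof -
  have "1 \<le> (1 - u) * (1 + 2 * u)"
    using assms mult_nonneg_nonneg[of u "1 - 2 * u"] by (simp add: algebra_simps)
  also have "\<dots> \<le> (1 - u) * exp (2 * u)"
    using assms by (intro mult_left_mono exp_ge_add_one_self) auto
  finally show ?thesis using assms by (simp add: field_simps)
qed

context prob_space
begin

text \<open>Both follow from the transform 1 / (1 - z^2): imaginary \<open>z\<close> gives the
  characteristic function, real \<open>z\<close> with |z| \<le> 1/2 the exponential bound.\<close>

lemma
  assumes X: "distributed M lborel X laplace_density"
  shows locally_subgaussian_laplace: "locally_subgaussian (1/2) 2 X"
    and char_laplace: "char (distr M borel X) t = of_real (1 / (1 + t\<^sup>2))"
proof -
  have [measurable]: "X \<in> borel_measurable M"
    using distributed_measurable[OF X] by simp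
  have [measurable]: "laplace_density \<in> borel_measurable borel"
    unfolding laplace_density_def by measurable
  have eq: "distr M borel X = density lborel laplace_density"
    using distributed_distr_eq_density[OF X] by (simp cong: distr_cong)
  have int: "integrable (distr M borel X) (\<lambda>x. exp (z * of_real x))"
    and val: "(\<integral>x. exp (z * of_real x) \<partial>distr M borel X) = 1 / (1 - z\<^sup>2)" if "\<bar>Re z\<bar> < 1" for z :: complex
    unfolding eq using laplace_integral[OF that]
    by (auto simp: integrable_density integral_density laplace_density_def)
  show "char (distr M borel X) t = of_real (1 / (1 + t\<^sup>2))"
    using val[of "\<i> * of_real t"] by (simp add: char_def power_mult_distrib mult_ac)
  show "locally_subgaussian (1/2) 2 X"
    unfolding locally_subgaussian_def
  proof (intro conjI allI impI)
    fix z :: real assume z: "\<bar>z\<bar> \<le> 1/2"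
    have "complex_integrable M (\<lambda>\<omega>. exp (of_real z * of_real (X \<omega>)))"
      using int[of "of_real z"] z by (simp add: integrable_distr_eq)
    moreover have e: "exp (of_real z * of_real x) = complex_of_real (exp (z * x))" for x
      by (simp only: of_real_mult[symmetric] exp_of_real)
    ultimately have "complex_integrable M (\<lambda>\<omega>. complex_of_real (exp (z * X \<omega>)))"
      by (simp only:)
    thus "integrable M (\<lambda>\<omega>. exp (z * X \<omega>))"
      by (simp only: complex_of_real_integrable_eq)
    have "complex_of_real (expectation (\<lambda>\<omega>. exp (z * X \<omega>))) = (\<integral>x. exp (of_real z * of_real x) \<partial>distr M borel X)"
      unfolding e integral_complex_of_real[symmetric] by (subst integral_distr) auto
    also have "\<dots> = of_real (1 / (1 - z\<^sup>2))"
      using val[of "of_real z"] z by simp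
    finally have "complex_of_real (expectation (\<lambda>\<omega>. exp (z * X \<omega>))) = of_real (1 / (1 - z\<^sup>2))" .
    hence "expectation (\<lambda>\<omega>. exp (z * X \<omega>)) = 1 / (1 - z\<^sup>2)"
      by (simp only: of_real_eq_iff)
    also have "\<dots> \<le> exp (2 * z\<^sup>2)"
    proof (rule exp_bound_inverse_one_minus)
      have "z\<^sup>2 \<le> (1/2)\<^sup>2" using z by (subst abs_le_square_iff[symmetric]) auto
      thus "z\<^sup>2 \<le> 1/2" by (simp add: power2_eq_square)
    qed simp
    finally show "expectation (\<lambda>\<omega>. exp (z * X \<omega>)) \<le> exp (2 * z\<^sup>2)" .
  qed measurable
qed

end

context prob_space
begin

text \<open>The product of the factors 1 / (1 + (t / (2 k + 1))^2) is written as the exponential of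
  a sum of logarithms, so that its limit is that of a convergent series.\<close>

lemma char_laplace_odd_series:
  assumes ind: "indep_vars (\<lambda>_. borel) X UNIV"
    and X: "\<And>k. distributed M lborel (X k) laplace_density"
    and sum: "AE \<omega> in M. summable (\<lambda>k. 1 / real (2 * k + 1) * X k \<omega>)"
  shows "char (distr M borel (\<lambda>\<omega>. \<Sum>k. 1 / real (2 * k + 1) * X k \<omega>)) t =
    of_real (exp (- (\<Sum>k. ln (1 + (t / real (2 * k + 1))\<^sup>2))))"
proof -
  have "summable (\<lambda>k. ln (1 + (t / real (2 * k + 1))\<^sup>2))"
  proof (rule summable_comparison_test')
    show "summable (\<lambda>k. t\<^sup>2 * (1 / (real (2 * k + 1))\<^sup>2))"
      by (intro summable_mult summable_recip_odd_squares)
    show "norm (ln (1 + (t / real (2 * k + 1))\<^sup>2)) \<le> t\<^sup>2 * (1 / (real (2 * k + 1))\<^sup>2)" if "k \<ge> 0" for k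
      using ln_add_one_self_le_self[of "(t / real (2 * k + 1))\<^sup>2"] by (simp add: power_divide)
  qed
  hence "(\<lambda>N. complex_of_real (exp (- (\<Sum>k<N. ln (1 + (t / real (2 * k + 1))\<^sup>2))))) \<longlonglongrightarrow>
      of_real (exp (- (\<Sum>k. ln (1 + (t / real (2 * k + 1))\<^sup>2))))"
    by (intro tendsto_of_real tendsto_exp tendsto_minus summable_LIMSEQ)
  moreover have "(\<Prod>k<N. char (distr M borel (X k)) (1 / real (2 * k + 1) * t)) =
      complex_of_real (exp (- (\<Sum>k<N. ln (1 + (t / real (2 * k + 1))\<^sup>2))))" for N
  proof -
    have "char (distr M borel (X k)) (1 / real (2 * k + 1) * t) =
        complex_of_real (exp (- ln (1 + (t / real (2 * k + 1))\<^sup>2)))" for k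
    proof -
      have "1 + (t / real (2 * k + 1))\<^sup>2 > 0" by (intro add_pos_nonneg) auto
      hence "exp (- ln (1 + (t / real (2 * k + 1))\<^sup>2)) = 1 / (1 + (t / real (2 * k + 1))\<^sup>2)"
        by (simp only: exp_minus exp_ln inverse_eq_divide)
      thus ?thesis by (simp only: char_laplace[OF X]) simp
    qed
    thus ?thesis
      by (simp only: of_real_prod[symmetric] exp_sum[symmetric] finite_lessThan sum_negf)
  qed
  ultimately show ?thesis
    using char_distr_weighted_suminf[OF ind sum, of t] LIMSEQ_unique by (simp only:)
qed

end

theorem mainTheorem5:
  fixes W :: "real measure"
    and M :: "'a measure"
    and L :: "nat \<Rightarrow> nat \<Rightarrow> 'a \<Rightarrow> real"
  assumes W_law: "real_distribution W"
    and W_limit: "weak_conv_m normalized_writhe_law W"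
    and W_mgf: "\<forall>\<^sub>F z in nhds (0::real).
          integrable W (\<lambda>x. exp (x * z)) \<and>
          (\<integral>x. exp (x * z) \<partial>W) = exp (\<Sum>m. writhe_lambda (Suc m) / real (Suc m) * z ^ Suc m)"
    and M: "prob_space M"
    and L_indep: "prob_space.indep_vars M (\<lambda>_. borel) (\<lambda>(m, n). L m n) {(m, n). odd m \<and> n \<ge> 1}"
    and L_laplace: "\<And>m n. odd m \<Longrightarrow> n \<ge> 1 \<Longrightarrow> distributed M lborel (L m n) laplace_density"
  shows "(AE \<omega> in M.
            (\<forall>n. summable (\<lambda>k. L (2 * k + 1) (Suc n) \<omega> / (real (2 * k + 1) * real (Suc n)))) \<and>
            summable (\<lambda>n. \<Sum>k. L (2 * k + 1) (Suc n) \<omega> / (real (2 * k + 1) * real (Suc n)))) \<and>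
         distr M borel
           (\<lambda>\<omega>. 4 / pi\<^sup>2 * (\<Sum>n. \<Sum>k. L (2 * k + 1) (Suc n) \<omega> / (real (2 * k + 1) * real (Suc n)))) = W"
proof -
  interpret prob_space M by fact
  \<comment> \<open>Shifted indices range over all naturals: row \<open>n\<close> holds the
    variables with second index \<open>n + 1\<close>. \<open>Y n\<close> is its weighted sum, and
    \<open>Z\<close> the weighted sum of the rows.\<close>
  define X where "X n k = L (2 * k + 1) (Suc n)" for n k
  define v w where "v k = 1 / real (2 * k + 1)" and "w n = 1 / real (Suc n)" for k n :: nat
  define Y where "Y n \<omega> = (\<Sum>k. v k * X n k \<omega>)" for n \<omega>
  define Z where "Z \<omega> = (\<Sum>n. w n * Y n \<omega>)" for \<omega>

  \<comment> \<open>Independence and almost sure convergence\<close>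
  have X: "distributed M lborel (X n k) laplace_density" for n k
    unfolding X_def by (rule L_laplace) auto
  have [measurable]: "X n k \<in> borel_measurable M" for n k
    using distributed_measurable[OF X] by simp
  have X_indep: "indep_vars (\<lambda>_. borel) (X n) UNIV" for n
  proof -
    \<comment> \<open>Singleton blocks transfer independence from pairs of indices to the single
      index \<open>k\<close>.\<close>
    define K where "K k = {(2 * k + 1, Suc n)}" for k :: nat
    have "indep_vars (\<lambda>k. PiM (K k) (\<lambda>_. borel)) (\<lambda>k \<omega>. restrict (\<lambda>i. (\<lambda>(m, n). L m n) i \<omega>) (K k)) UNIV"
      by (rule indep_vars_restrict[OF L_indep]) (auto simp: K_def disjoint_family_on_def)
    hence "indep_vars (\<lambda>_. borel) (\<lambda>k \<omega>. restrict (\<lambda>i. (\<lambda>(m, n). L m n) i \<omega>) (K k) (2 * k + 1, Suc n)) UNIV"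
      by (rule indep_vars_compose2) (rule measurable_component_singleton, simp add: K_def)
    moreover have "restrict (\<lambda>i. (\<lambda>(m, n). L m n) i \<omega>) (K k) (2 * k + 1, Suc n) = X n k \<omega>" for k \<omega>
      by (simp add: K_def X_def)
    ultimately show ?thesis by (simp only:)
  qed
  have v: "\<bar>v k\<bar> \<le> 1 / real (Suc k)" "\<bar>v k - v (Suc k)\<bar> \<le> 2 / (real (Suc k))\<^sup>2" "\<bar>v k\<bar> \<le> 1" for k
  proof -
    show "\<bar>v k\<bar> \<le> 1 / real (Suc k)" "\<bar>v k\<bar> \<le> 1"
      by (auto simp: v_def divide_simps)
    have "\<bar>v k - v (Suc k)\<bar> = 2 / (real (2 * k + 1) * real (2 * Suc k + 1))"
      by (simp add: v_def divide_simps)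
    also have "\<dots> \<le> 2 / (real (Suc k) * real (Suc k))"
      by (intro divide_left_mono mult_mono) auto
    finally show "\<bar>v k - v (Suc k)\<bar> \<le> 2 / (real (Suc k))\<^sup>2"
      by (simp only: power2_eq_square)
  qed
  have w: "\<bar>w n\<bar> \<le> 1 / real (Suc n)" "\<bar>w n - w (Suc n)\<bar> \<le> 2 / (real (Suc n))\<^sup>2" "\<bar>w n\<bar> \<le> 1" for n
  proof -
    show "\<bar>w n\<bar> \<le> 1 / real (Suc n)" "\<bar>w n\<bar> \<le> 1"
      by (auto simp: w_def divide_simps)
    have "\<bar>w n - w (Suc n)\<bar> = 1 / (real (Suc n) * real (Suc (Suc n)))"
      by (simp add: w_def divide_simps)
    also have "\<dots> \<le> 2 / (real (Suc n) * real (Suc n))"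
      by (intro frac_le mult_mono) auto
    finally show "\<bar>w n - w (Suc n)\<bar> \<le> 2 / (real (Suc n))\<^sup>2"
      by (simp only: power2_eq_square)
  qed
  have v2: "summable (\<lambda>k. (v k)\<^sup>2)" and w2: "summable (\<lambda>n. (w n)\<^sup>2)"
    using summable_recip_odd_squares summable_recip_squares by (simp_all add: v_def w_def power_divide)

  have X_summable: "AE \<omega> in M. summable (\<lambda>k. v k * X n k \<omega>)" for n
    by (rule AE_summable_weighted_indep[OF X_indep locally_subgaussian_laplace[OF X] _ v(1,2)]) simp
  hence X_summable_all: "AE \<omega> in M. \<forall>n. summable (\<lambda>k. v k * X n k \<omega>)"
    by (simp add: AE_all_countable)
  define C where "C = 2 * (\<Sum>k. (v k)\<^sup>2)"
  have Y: "locally_subgaussian (1/2) C (Y n)" for n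
    unfolding C_def Y_def[abs_def]
    by (rule locally_subgaussian_suminf[OF X_indep locally_subgaussian_laplace[OF X] _ v(3) v2 X_summable]) simp
  have C: "0 \<le> C"
    unfolding C_def using v2 by (intro mult_nonneg_nonneg suminf_nonneg) auto
  have Y_indep: "indep_vars (\<lambda>_. borel) Y UNIV"
  proof -
    \<comment> \<open>The block \<open>K n\<close> is a whole row. Rows are disjoint, and each row
      sum is a measurable function of its row.\<close>
    define K where "K n = {(m :: nat, n'). odd m \<and> n' = Suc n}" for n :: nat
    define g where "g n h = (\<Sum>k. v k * h (2 * k + 1, Suc n))" for n :: nat and h :: "nat \<times> nat \<Rightarrow> real"
    have "indep_vars (\<lambda>n. PiM (K n) (\<lambda>_. borel)) (\<lambda>n \<omega>. restrict (\<lambda>i. (\<lambda>(m, n). L m n) i \<omega>) (K n)) UNIV"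
      by (rule indep_vars_restrict[OF L_indep]) (auto simp: K_def disjoint_family_on_def)
    hence "indep_vars (\<lambda>_. borel) (\<lambda>n \<omega>. g n (restrict (\<lambda>i. (\<lambda>(m, n). L m n) i \<omega>) (K n))) UNIV"
    proof (rule indep_vars_compose2)
      fix n
      have [measurable]: "(\<lambda>h. h (2 * k + 1, Suc n)) \<in> borel_measurable (PiM (K n) (\<lambda>_. borel))" for k
        by (rule measurable_component_singleton) (simp add: K_def)
      show "g n \<in> borel_measurable (PiM (K n) (\<lambda>_. borel))"
        unfolding g_def[abs_def] by measurable
    qed
    moreover have "g n (restrict (\<lambda>i. (\<lambda>(m, n). L m n) i \<omega>) (K n)) = Y n \<omega>" for n \<omega>
      by (simp add: g_def Y_def X_def K_def)
    ultimately show ?thesis by simp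
  qed
  have Y_summable: "AE \<omega> in M. summable (\<lambda>n. w n * Y n \<omega>)"
    by (rule AE_summable_weighted_indep[OF Y_indep Y _ w(1,2)]) simp
  have Z: "locally_subgaussian (1/2) (C * (\<Sum>n. (w n)\<^sup>2)) Z"
    unfolding Z_def[abs_def]
    by (rule locally_subgaussian_suminf[OF Y_indep Y C w(3) w2 Y_summable])
  hence [measurable]: "Z \<in> borel_measurable M"
    by (simp add: locally_subgaussian_def)

  have term_eq: "L (2 * k + 1) (Suc n) \<omega> / (real (2 * k + 1) * real (Suc n)) = w n * (v k * X n k \<omega>)" for k n \<omega>
    by (simp add: w_def v_def X_def)
  have series: "AE \<omega> in M. (\<forall>n. summable (\<lambda>k. L (2 * k + 1) (Suc n) \<omega> / (real (2 * k + 1) * real (Suc n)))) \<and>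
      summable (\<lambda>n. \<Sum>k. L (2 * k + 1) (Suc n) \<omega> / (real (2 * k + 1) * real (Suc n))) \<and>
      (\<Sum>n. \<Sum>k. L (2 * k + 1) (Suc n) \<omega> / (real (2 * k + 1) * real (Suc n))) = Z \<omega>"
    using X_summable_all Y_summable
  proof eventually_elim
    case (elim \<omega>)
    have "(\<Sum>k. w n * (v k * X n k \<omega>)) = w n * Y n \<omega>" for n
      using elim(1) unfolding Y_def by (intro suminf_mult) auto
    with elim show ?case
      unfolding term_eq Z_def by (auto intro: summable_mult)
  qed
  define P where "P = distr M borel (\<lambda>\<omega>. 4 / pi\<^sup>2 * Z \<omega>)"
  have L_meas: "L (2 * k + 1) (Suc n) \<in> borel_measurable M" for n k
    using \<open>\<And>n k. X n k \<in> borel_measurable M\<close> by (simp add: X_def)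
  \<comment> \<open>The given double sum and \<open>Z\<close> are known to agree almost surely,
    where the row series converge and \<open>w n\<close> can be taken out of them; with
    measurability this gives equal laws.\<close>
  have P_eq: "distr M borel
      (\<lambda>\<omega>. 4 / pi\<^sup>2 * (\<Sum>n. \<Sum>k. L (2 * k + 1) (Suc n) \<omega> / (real (2 * k + 1) * real (Suc n)))) = P"
    unfolding P_def
  proof (rule distr_cong_AE)
    show "AE \<omega> in M. 4 / pi\<^sup>2 * (\<Sum>n. \<Sum>k. L (2 * k + 1) (Suc n) \<omega> / (real (2 * k + 1) * real (Suc n))) =
        4 / pi\<^sup>2 * Z \<omega>"
      using series by eventually_elim simp
    show "(\<lambda>\<omega>. 4 / pi\<^sup>2 * (\<Sum>n. \<Sum>k. L (2 * k + 1) (Suc n) \<omega> / (real (2 * k + 1) * real (Suc n)))) \<in> borel_measurable M"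
      unfolding term_eq by measurable
  qed auto

  \<comment> \<open>Characteristic function of the scaled double series\<close>
  have scale: "\<bar>4 / pi\<^sup>2 * t\<bar> \<le> \<bar>t\<bar>" for t
  proof -
    have "pi\<^sup>2 \<ge> 2\<^sup>2" using pi_ge_two by (intro power_mono) auto
    hence "4 / pi\<^sup>2 \<le> 1" by simp
    hence "4 / pi\<^sup>2 * \<bar>t\<bar> \<le> 1 * \<bar>t\<bar>" by (rule mult_right_mono) simp
    thus ?thesis by (simp add: abs_mult)
  qed
  \<comment> \<open>Two successive limits: the product within row \<open>n\<close> gives
    \<open>exp (- ?l n)\<close>, the product over the rows gives \<open>exp (- S)\<close>.\<close>
  have char_P: "char P t = exp (\<Sum>m. complex_of_real (writhe_lambda m / real m) * (\<i> * of_real t) ^ m)"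
    if t: "\<bar>t\<bar> < 1" for t
  proof -
    have c: "\<bar>4 / pi\<^sup>2 * t\<bar> < 1"
      using scale t by (rule le_less_trans)
    let ?l = "\<lambda>n. \<Sum>k. ln (1 + (4 / pi\<^sup>2 * t / real (Suc n) / real (2 * k + 1))\<^sup>2)"
    obtain S where S: "?l sums S"
      "(\<lambda>m. complex_of_real (writhe_lambda m / real m) * (\<i> * of_real t) ^ m) sums of_real (- S)"
      using writhe_lambda_imaginary_series[OF c] by blast
    have "(\<lambda>N. \<Prod>n<N. char (distr M borel (Y n)) (w n * (4 / pi\<^sup>2 * t))) \<longlonglongrightarrow>
        char (distr M borel Z) (4 / pi\<^sup>2 * t)"
      unfolding Z_def[abs_def] by (rule char_distr_weighted_suminf[OF Y_indep Y_summable])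
    moreover have "char (distr M borel (Y n)) (w n * (4 / pi\<^sup>2 * t)) = of_real (exp (- ?l n))" for n
    proof -
      have "w n * (4 / pi\<^sup>2 * t) = 4 / pi\<^sup>2 * t / real (Suc n)" by (simp add: w_def)
      thus ?thesis
        unfolding Y_def[abs_def] v_def
        using char_laplace_odd_series[OF X_indep X X_summable[unfolded v_def]] by (simp only:)
    qed
    hence "(\<Prod>n<N. char (distr M borel (Y n)) (w n * (4 / pi\<^sup>2 * t))) = of_real (exp (- (\<Sum>n<N. ?l n)))" for N
      by (simp only: of_real_prod[symmetric] exp_sum[symmetric] finite_lessThan sum_negf)
    moreover have "(\<lambda>N. complex_of_real (exp (- (\<Sum>n<N. ?l n)))) \<longlonglongrightarrow> of_real (exp (- S))"
      using S(1) unfolding sums_def by (intro tendsto_of_real tendsto_exp tendsto_minus)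
    ultimately have "char (distr M borel Z) (4 / pi\<^sup>2 * t) = of_real (exp (- S))"
      using LIMSEQ_unique by (simp only:)
    moreover have "char P t = char (distr M borel Z) (4 / pi\<^sup>2 * t)"
      by (simp add: P_def char_def integral_distr mult_ac)
    ultimately show ?thesis
      unfolding sums_unique[OF S(2), symmetric] by (simp only: exp_of_real)
  qed

  \<comment> \<open>Exponential moments and comparison with the limit law\<close>
  have P_law: "real_distribution P"
    unfolding P_def by (rule real_distribution_distr) measurable
  have P_exp: "integrable P (\<lambda>x. exp (d * \<bar>x\<bar>))" if "0 \<le> d" "d \<le> 1/2" for d
  proof (rule real_distribution.integrable_exp_abs[OF P_law _ _ that])
    have "integrable P (\<lambda>x. exp (z * x))" if "\<bar>z\<bar> \<le> 1/2" for z
    proof -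
      have "\<bar>4 / pi\<^sup>2 * z\<bar> \<le> 1/2"
        using scale that by (rule order_trans)
      hence "integrable M (\<lambda>\<omega>. exp (4 / pi\<^sup>2 * z * Z \<omega>))"
        using Z by (simp only: locally_subgaussian_def)
      thus ?thesis by (simp add: P_def integrable_distr_eq mult_ac)
    qed
    from this[of "1/2"] this[of "- (1/2)"]
    show "integrable P (\<lambda>x. exp (1/2 * x))" "integrable P (\<lambda>x. exp (- (1/2) * x))" by auto
  qed

  obtain q where q: "q > 0" "\<And>z. \<bar>z\<bar> < q \<Longrightarrow> integrable W (\<lambda>x. exp (x * z))"
    using W_mgf unfolding eventually_nhds_metric by (auto simp: dist_norm)
  \<comment> \<open>A common exponent: 1/2 is the range established for \<open>P\<close>, and q/2
    keeps both \<open>d\<close> and \<open>- d\<close> strictly inside the range known for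
    \<open>W\<close>.\<close>
  define d where "d = min (1/2) (q/2)"
  have d: "d > 0" "d \<le> 1/2" "d < q" using q by (auto simp: d_def)
  have W_exp: "integrable W (\<lambda>x. exp (d * \<bar>x\<bar>))"
    using q(2)[of d] q(2)[of "- d"] d
    by (intro real_distribution.integrable_exp_abs[OF W_law, of d]) (auto simp: mult.commute)
  have lambda_summable: "summable (\<lambda>m. writhe_lambda m / real m * z ^ m)" if "\<bar>z\<bar> < 1" for z
    using summable_writhe_lambda le_less_trans[OF scale that] .
  have "\<forall>\<^sub>F z in nhds 0. \<bar>z\<bar> < (1::real)"
    unfolding eventually_nhds_metric by (auto intro!: exI[of _ 1])
  hence "\<forall>\<^sub>F z in nhds 0. (\<integral>x. exp (x * z) \<partial>W) = exp (\<Sum>m. writhe_lambda m / real m * z ^ m)"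
    using W_mgf
  proof eventually_elim
    case (elim z)
    \<comment> \<open>The term of index 0 is 0, so the series may start there.\<close>
    have "(\<Sum>m. writhe_lambda (Suc m) / real (Suc m) * z ^ Suc m) = (\<Sum>m. writhe_lambda m / real m * z ^ m)"
      using suminf_split_head[OF lambda_summable[OF elim(1)]] by simp
    with elim(2) show ?case by simp
  qed
  then obtain s where s: "s > 0" "\<And>t. \<bar>t\<bar> < s \<Longrightarrow>
      char W t = exp (\<Sum>m. of_real (writhe_lambda m / real m) * (\<i> * of_real t) ^ m)"
    using char_from_mgf_power_series[OF W_law d(1) W_exp zero_less_one lambda_summable] by blast
  have "P = W"
  proof (rule real_distribution_eqI_char_near_0[OF P_law W_law d(1) P_exp W_exp])
    show "min s 1 > 0" using s by simp
    show "char P t = char W t" if "\<bar>t\<bar> < min s 1" for t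
      using char_P[of t] s(2)[of t] that by simp
  qed (use d in auto)
  with series P_eq show ?thesis
    by (auto elim: eventually_mono)
qed

end
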